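(* Let $\mathfrak g$ be an arbitrary complex Lie algebra and let $\pi:U(\mathfrak g)\to\mathrm{End}(V)$ be a faithful representation of $\mathfrak g$ (i.e. $\pi|_{\mathfrak g}$ is injective). Let $$\Psi:U(\mathfrak g)\to\prod_{k\in\mathbb N}\mathrm{End}(V^{\otimes k})$$ be the map whose component at each $n\in\mathbb N$ is $\pi_n$. Then $\Psi$ is an injective homomorphism of algebras.
   Context: $\mathbb N$ is the set of non-negative integers. $\Delta$ and $\varepsilon$ denote the standard coproduct and counit of $U(\mathfrak g)$. $\Delta^{(0)}=\mathrm{id}$ and $\Delta^{(k)}=(\mathrm{id}^{\otimes(k-1)}\otimes\Delta)\circ\Delta^{(k-1)}:U(\mathfrak g)\to U(\mathfrak g)^{\otimes(k+1)}$ for $k\geq 1$. For $k>0$, $\pi_k=\pi^{\otimes k}\circ\Delta^{(k-1)}:U(\mathfrak g)\to\mathrm{End}(V)^{\otimes k}\subset\mathrm{End}(V^{\otimes k})$, and $\pi_0=\varepsilon:U(\mathfrak g)\to\mathbb C=\mathrm{End}(V^{\otimes0})$. *)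

theory Defs
  imports Complex_Main "HOL-Library.Poly_Mapping" "HOL-Library.FuncSet"
begin

section \<open>Complex vector spaces, associative algebras and Lie algebras\<close>

class scaleC =
  fixes scaleC :: "complex \<Rightarrow> 'a \<Rightarrow> 'a" (infixr \<open>*\<^sub>C\<close> 75)

class complex_vector = scaleC + ab_group_add +
  assumes scaleC_add_right: "a *\<^sub>C (x + y) = a *\<^sub>C x + a *\<^sub>C y"
    and scaleC_add_left: "(a + b) *\<^sub>C x = a *\<^sub>C x + b *\<^sub>C x"
    and scaleC_scaleC: "a *\<^sub>C (b *\<^sub>C x) = (a * b) *\<^sub>C x"
    and scaleC_one: "1 *\<^sub>C x = x"

global_interpretation cv: vector_space "scaleC :: complex \<Rightarrow> 'a \<Rightarrow> 'a::complex_vector"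
  by unfold_locales (rule scaleC_add_right scaleC_add_left scaleC_scaleC scaleC_one)+

abbreviation clinear :: "('a::complex_vector \<Rightarrow> 'b::complex_vector) \<Rightarrow> bool"
  where "clinear \<equiv> Vector_Spaces.linear scaleC scaleC"

lemma clinear_iff:
  "clinear f \<longleftrightarrow> (\<forall>x y. f (x + y) = f x + f y) \<and> (\<forall>c x. f (c *\<^sub>C x) = c *\<^sub>C f x)"
  by (auto simp: Vector_Spaces.linear_iff cv.vector_space_axioms)

lemma clinear_add: "clinear f \<Longrightarrow> f (x + y) = f x + f y"
  and clinear_scale: "clinear f \<Longrightarrow> f (c *\<^sub>C x) = c *\<^sub>C f x"
  by (simp_all add: clinear_iff)

lemma clinear_0: "clinear f \<Longrightarrow> f 0 = 0"
  using clinear_add[of f 0 0] by simp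

lemma clinear_diff: "clinear f \<Longrightarrow> f (x - y) = f x - f y"
  by (metis add_diff_cancel_right' clinear_add diff_add_cancel)

lemma clinear_sum: "clinear f \<Longrightarrow> f (sum g A) = (\<Sum>x\<in>A. f (g x))"
  by (induction A rule: infinite_finite_induct) (simp_all add: clinear_0 clinear_add)

lemma clinear_compose: "clinear f \<Longrightarrow> clinear g \<Longrightarrow> clinear (\<lambda>x. f (g x))"
  by (simp add: clinear_iff)

lemma clinear_subspace_vimage:
  assumes "clinear f" "cv.subspace S" shows "cv.subspace {x. f x \<in> S}"
  using assms unfolding cv.subspace_def
  by (simp add: clinear_0 clinear_add clinear_scale)

text \<open>Rings are unital, but \<open>0 = 1\<close> is allowed: \<open>End(V)\<close> is an algebra also for \<open>V = 0\<close>.\<close>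

class complex_algebra = complex_vector + ring + monoid_mult +
  assumes mult_scaleC_left: "(a *\<^sub>C x) * y = a *\<^sub>C (x * y)"
    and mult_scaleC_right: "x * (a *\<^sub>C y) = a *\<^sub>C (x * y)"

definition algebra_hom :: "('a::complex_algebra \<Rightarrow> 'b::complex_algebra) \<Rightarrow> bool"
  where "algebra_hom f \<longleftrightarrow> clinear f \<and> (\<forall>x y. f (x * y) = f x * f y) \<and> f 1 = 1"

class complex_lie_algebra = complex_vector +
  fixes lie_bracket :: "'a \<Rightarrow> 'a \<Rightarrow> 'a"
  assumes lie_add_left: "lie_bracket (x + y) z = lie_bracket x z + lie_bracket y z"
    and lie_add_right: "lie_bracket x (y + z) = lie_bracket x y + lie_bracket x z"
    and lie_scaleC_left: "lie_bracket (c *\<^sub>C x) y = c *\<^sub>C lie_bracket x y"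
    and lie_scaleC_right: "lie_bracket x (c *\<^sub>C y) = c *\<^sub>C lie_bracket x y"
    and lie_alternating: "lie_bracket x x = 0"
    and lie_jacobi: "lie_bracket x (lie_bracket y z) + lie_bracket y (lie_bracket z x)
          + lie_bracket z (lie_bracket x y) = 0"

instantiation complex :: complex_algebra
begin
definition scaleC_complex :: "complex \<Rightarrow> complex \<Rightarrow> complex"
  where "scaleC_complex = (*)"
instance
  by standard (simp_all add: scaleC_complex_def algebra_simps)
end

instantiation poly_mapping :: (type, complex_vector) complex_vector
begin
lift_definition scaleC_poly_mapping :: "complex \<Rightarrow> ('a \<Rightarrow>\<^sub>0 'b) \<Rightarrow> 'a \<Rightarrow>\<^sub>0 'b"
  is "\<lambda>c p k. c *\<^sub>C p k"
  by (erule finite_subset[rotated]) auto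
instance
  by standard (transfer, simp add: scaleC_add_right scaleC_add_left scaleC_scaleC scaleC_one)+
end

section \<open>The algebra of endomorphisms of a vector space\<close>

typedef (overloaded) 'v endo = "{f :: 'v::complex_vector \<Rightarrow> 'v. clinear f}"
  morphisms endo_apply Abs_endo
  by (rule exI[of _ "\<lambda>x. x"]) (simp add: clinear_iff)

setup_lifting type_definition_endo

lemma clinear_endo_apply: "clinear (endo_apply f)"
  using endo_apply by auto

instantiation endo :: (complex_vector) complex_algebra
begin
lift_definition zero_endo :: "'a endo" is "\<lambda>x. 0"
  by (simp add: clinear_iff)
lift_definition one_endo :: "'a endo" is "\<lambda>x. x"
  by (simp add: clinear_iff)
lift_definition plus_endo :: "'a endo \<Rightarrow> 'a endo \<Rightarrow> 'a endo" is "\<lambda>f g x. f x + g x"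
  by (simp add: clinear_iff scaleC_add_right algebra_simps)
lift_definition uminus_endo :: "'a endo \<Rightarrow> 'a endo" is "\<lambda>f x. - f x"
  by (simp add: clinear_iff)
lift_definition minus_endo :: "'a endo \<Rightarrow> 'a endo \<Rightarrow> 'a endo" is "\<lambda>f g x. f x - g x"
  by (simp add: clinear_iff cv.scale_right_diff_distrib algebra_simps)
lift_definition times_endo :: "'a endo \<Rightarrow> 'a endo \<Rightarrow> 'a endo" is "\<lambda>f g x. f (g x)"
  by (simp add: clinear_iff)
lift_definition scaleC_endo :: "complex \<Rightarrow> 'a endo \<Rightarrow> 'a endo" is "\<lambda>c f x. c *\<^sub>C f x"
  by (simp add: clinear_iff scaleC_add_right scaleC_scaleC mult.commute)
instance
  by standard
    (transfer, simp add: clinear_iff algebra_simps scaleC_add_right scaleC_add_left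
      scaleC_scaleC scaleC_one fun_eq_iff)+
end

section \<open>Tensor powers and the tensor algebra\<close>

text \<open>
  The tensor algebra \<open>\<Oplus>\<^sub>k V\<^sup>\<otimes>\<^sup>k\<close> is the free vector space on all tuples of vectors
  modulo the relations of multilinearity; \<open>tprod [v1, ..., vk]\<close> is the class of a tuple, and
  \<open>V\<^sup>\<otimes>\<^sup>k\<close> is the span of the classes of \<open>k\<close>-tuples.
\<close>

definition tuple :: "'a list \<Rightarrow> 'a list \<Rightarrow>\<^sub>0 complex"
  where "tuple us = Poly_Mapping.single us 1"

definition multilinear_relations :: "('a::complex_vector list \<Rightarrow>\<^sub>0 complex) set"
  where "multilinear_relations =
    {tuple (us @ (x + y) # ws) - tuple (us @ x # ws) - tuple (us @ y # ws) | us x y ws. True}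
    \<union> {tuple (us @ (c *\<^sub>C x) # ws) - c *\<^sub>C tuple (us @ x # ws) | us c x ws. True}"

quotient_type (overloaded) 'a tensor =
  "'a::complex_vector list \<Rightarrow>\<^sub>0 complex" / "\<lambda>p q. p - q \<in> cv.span multilinear_relations"
proof (rule equivpI)
  show "reflp (\<lambda>p q :: 'a list \<Rightarrow>\<^sub>0 complex. p - q \<in> cv.span multilinear_relations)"
    by (rule reflpI) (simp add: cv.span_zero)
  show "symp (\<lambda>p q :: 'a list \<Rightarrow>\<^sub>0 complex. p - q \<in> cv.span multilinear_relations)"
    by (rule sympI) (use cv.span_neg in fastforce)
  show "transp (\<lambda>p q :: 'a list \<Rightarrow>\<^sub>0 complex. p - q \<in> cv.span multilinear_relations)"
    by (rule transpI) (use cv.span_add in fastforce)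
qed

instantiation tensor :: (complex_vector) complex_vector
begin
lift_definition zero_tensor :: "'a tensor" is 0 .
lift_definition plus_tensor :: "'a tensor \<Rightarrow> 'a tensor \<Rightarrow> 'a tensor" is "(+)"
  by (metis add_diff_add cv.span_add)
lift_definition uminus_tensor :: "'a tensor \<Rightarrow> 'a tensor" is uminus
  by (metis cv.span_neg minus_diff_minus)
lift_definition minus_tensor :: "'a tensor \<Rightarrow> 'a tensor \<Rightarrow> 'a tensor" is "(-)"
proof -
  fix p q r s :: "'a list \<Rightarrow>\<^sub>0 complex"
  assume "p - q \<in> cv.span multilinear_relations" "r - s \<in> cv.span multilinear_relations"
  then have "(p - q) - (r - s) \<in> cv.span multilinear_relations" by (rule cv.span_diff)
  then show "p - r - (q - s) \<in> cv.span multilinear_relations" by (simp add: algebra_simps)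
qed
lift_definition scaleC_tensor :: "complex \<Rightarrow> 'a tensor \<Rightarrow> 'a tensor" is "(*\<^sub>C)"
  by (metis cv.span_scale cv.scale_right_diff_distrib)
instance
  by standard
    (transfer, simp add: cv.span_zero scaleC_add_right scaleC_add_left scaleC_scaleC
      scaleC_one algebra_simps)+
end

lift_definition tprod :: "'a::complex_vector list \<Rightarrow> 'a tensor" is tuple .

definition tensor_power :: "nat \<Rightarrow> 'a::complex_vector tensor set"
  where "tensor_power k = cv.span {tprod us | us. length us = k}"

definition multilinear :: "('a::complex_vector list \<Rightarrow> 'b::complex_vector) \<Rightarrow> bool"
  where "multilinear f \<longleftrightarrow> (\<forall>us ws. clinear (\<lambda>x. f (us @ x # ws)))"

lemma multilinearD: "multilinear f \<Longrightarrow> clinear (\<lambda>x. f (us @ x # ws))"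
  by (simp only: multilinear_def)

definition free_lift :: "('a list \<Rightarrow> 'b::complex_vector) \<Rightarrow> ('a list \<Rightarrow>\<^sub>0 complex) \<Rightarrow> 'b"
  where "free_lift f p = (\<Sum>us\<in>Poly_Mapping.keys p. Poly_Mapping.lookup p us *\<^sub>C f us)"

text \<open>
  For multilinear \<open>f\<close>, \<open>tensor_lift f\<close> is the unique linear map with
  \<open>tensor_lift f (tprod us) = f us\<close>; the choice of a representative is then immaterial.
\<close>

definition tensor_lift :: "('a::complex_vector list \<Rightarrow> 'b::complex_vector) \<Rightarrow> 'a tensor \<Rightarrow> 'b"
  where "tensor_lift f t = free_lift f (rep_tensor t)"

lemma free_lift_superset:
  assumes "finite A" "Poly_Mapping.keys p \<subseteq> A"
  shows "free_lift f p = (\<Sum>us\<in>A. Poly_Mapping.lookup p us *\<^sub>C f us)"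
  unfolding free_lift_def
  by (rule sum.mono_neutral_left) (use assms in \<open>auto simp: in_keys_iff\<close>)

lemma clinear_free_lift: "clinear (free_lift f)"
  unfolding clinear_iff
proof (intro conjI allI)
  fix p q :: "'a list \<Rightarrow>\<^sub>0 complex" and c
  let ?A = "Poly_Mapping.keys p \<union> Poly_Mapping.keys q"
  have "Poly_Mapping.keys (p + q) \<subseteq> ?A" by (rule Poly_Mapping.keys_add)
  then show "free_lift f (p + q) = free_lift f p + free_lift f q"
    by (simp add: free_lift_superset[of ?A] lookup_add scaleC_add_left sum.distrib)
  have "Poly_Mapping.keys (c *\<^sub>C p) \<subseteq> Poly_Mapping.keys p"
    by (auto simp: in_keys_iff scaleC_poly_mapping.rep_eq)
  then show "free_lift f (c *\<^sub>C p) = c *\<^sub>C free_lift f p"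
    by (simp add: free_lift_superset[of "Poly_Mapping.keys p"] scaleC_poly_mapping.rep_eq
        cv.scale_sum_right scaleC_scaleC scaleC_complex_def)
qed

lemma free_lift_tuple [simp]: "free_lift f (tuple us) = f us"
  by (simp add: free_lift_def tuple_def scaleC_one)

lemma free_lift_relations:
  assumes "multilinear f" "p \<in> cv.span multilinear_relations" shows "free_lift f p = 0"
  using assms(2)
proof (induction rule: cv.span_induct)
  case base
  show ?case
    using clinear_subspace_vimage[OF clinear_free_lift[of f] cv.subspace_single_0] by simp
next
  case (step p)
  note lin = clinear_diff[OF clinear_free_lift] clinear_scale[OF clinear_free_lift]
  have "f (us @ (x + y) # ws) = f (us @ x # ws) + f (us @ y # ws)"
    "f (us @ (c *\<^sub>C x) # ws) = c *\<^sub>C f (us @ x # ws)" for us x y ws c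
    using assms(1) by (simp_all add: multilinear_def clinear_iff)
  note f = this
  from step show ?case
    unfolding multilinear_relations_def by (elim UnE CollectE exE) (simp_all add: lin f)
qed

lemma free_lift_eq:
  assumes "multilinear f" "p - q \<in> cv.span multilinear_relations"
  shows "free_lift f p = free_lift f q"
  using free_lift_relations[OF assms] by (simp add: clinear_diff[OF clinear_free_lift])

lemma abs_rep_tensor: "abs_tensor (rep_tensor t) = t"
  by (rule Quotient3_abs_rep[OF Quotient3_tensor])

lemma rep_abs_tensor: "rep_tensor (abs_tensor p) - p \<in> cv.span multilinear_relations"
  using abs_rep_tensor[of "abs_tensor p"] by (simp only: tensor.abs_eq_iff)

lemma tensor_lift_abs: "multilinear f \<Longrightarrow> tensor_lift f (abs_tensor p) = free_lift f p"
  unfolding tensor_lift_def by (rule free_lift_eq[OF _ rep_abs_tensor])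

lemma tensor_lift_tprod [simp]: "multilinear f \<Longrightarrow> tensor_lift f (tprod us) = f us"
  by (simp add: tprod.abs_eq tensor_lift_abs)

lemma clinear_tensor_lift:
  assumes "multilinear f" shows "clinear (tensor_lift f)"
proof -
  have "tensor_lift f (abs_tensor p + abs_tensor q)
      = tensor_lift f (abs_tensor p) + tensor_lift f (abs_tensor q)" for p q
    using assms by (simp add: plus_tensor.abs_eq tensor_lift_abs clinear_add[OF clinear_free_lift])
  note add = this[of "rep_tensor s" "rep_tensor t" for s t]
  have "tensor_lift f (c *\<^sub>C abs_tensor p) = c *\<^sub>C tensor_lift f (abs_tensor p)" for p c
    using assms
    by (simp add: scaleC_tensor.abs_eq tensor_lift_abs clinear_scale[OF clinear_free_lift])
  note scale = this[of _ "rep_tensor s" for s]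
  show ?thesis
    using add scale by (simp add: clinear_iff abs_rep_tensor)
qed

lemma multilinear_tprod: "multilinear tprod"
proof -
  have "tprod (us @ (x + y) # ws) = tprod (us @ x # ws) + tprod (us @ y # ws)"
    for us ws and x y :: 'a
  proof -
    have "tuple (us @ (x + y) # ws) - tuple (us @ x # ws) - tuple (us @ y # ws)
        \<in> multilinear_relations"
      unfolding multilinear_relations_def
      by (rule UnI1, rule CollectI, rule exI[of _ us], rule exI[of _ x], rule exI[of _ y],
          rule exI[of _ ws]) simp
    from cv.span_base[OF this] show ?thesis
      by (simp only: tprod.abs_eq plus_tensor.abs_eq tensor.abs_eq_iff diff_diff_add)
  qed
  moreover have "tprod (us @ (c *\<^sub>C x) # ws) = c *\<^sub>C tprod (us @ x # ws)" for us ws c and x :: 'a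
  proof -
    have "tuple (us @ (c *\<^sub>C x) # ws) - c *\<^sub>C tuple (us @ x # ws) \<in> multilinear_relations"
      unfolding multilinear_relations_def
      by (rule UnI2, rule CollectI, rule exI[of _ us], rule exI[of _ c], rule exI[of _ x],
          rule exI[of _ ws]) simp
    from cv.span_base[OF this] show ?thesis
      by (simp only: tprod.abs_eq scaleC_tensor.abs_eq tensor.abs_eq_iff)
  qed
  ultimately show ?thesis
    by (simp add: multilinear_def clinear_iff)
qed

lemma tensor_lift_fun_linear:
  "tensor_lift (\<lambda>us. f us + g us) t = tensor_lift f t + tensor_lift g t"
  "tensor_lift (\<lambda>us. c *\<^sub>C f us) t = c *\<^sub>C tensor_lift f t"
  by (simp_all add: tensor_lift_def free_lift_def scaleC_add_right sum.distrib
      cv.scale_sum_right scaleC_scaleC mult.commute)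

lemma tensor_lift_in_subspace:
  "cv.subspace S \<Longrightarrow> (\<And>us. f us \<in> S) \<Longrightarrow> tensor_lift f t \<in> S"
  by (simp add: tensor_lift_def free_lift_def cv.subspace_sum cv.subspace_scale)

lemma abs_tensor_eq_sum:
  "abs_tensor p = free_lift tprod p"
proof -
  have lin: "clinear (abs_tensor :: ('a list \<Rightarrow>\<^sub>0 complex) \<Rightarrow> 'a tensor)"
    by (simp add: clinear_iff plus_tensor.abs_eq scaleC_tensor.abs_eq)
  have "p = (\<Sum>us\<in>Poly_Mapping.keys p. Poly_Mapping.lookup p us *\<^sub>C tuple us)"
  proof (rule poly_mapping_eqI)
    fix k
    have "(\<Sum>us\<in>Poly_Mapping.keys p. Poly_Mapping.lookup p us * (1 when us = k))
        = (\<Sum>us\<in>Poly_Mapping.keys p. if us = k then Poly_Mapping.lookup p us else 0)"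
      by (rule sum.cong) (auto simp: when_def)
    then show "Poly_Mapping.lookup p k
        = Poly_Mapping.lookup (\<Sum>us\<in>Poly_Mapping.keys p. Poly_Mapping.lookup p us *\<^sub>C tuple us) k"
      by (simp add: lookup_sum scaleC_poly_mapping.rep_eq tuple_def lookup_single
          scaleC_complex_def in_keys_iff)
  qed
  then have "abs_tensor p
      = abs_tensor (\<Sum>us\<in>Poly_Mapping.keys p. Poly_Mapping.lookup p us *\<^sub>C tuple us)" by simp
  then show ?thesis
    by (simp add: clinear_sum[OF lin] clinear_scale[OF lin] tprod.abs_eq free_lift_def)
qed

lemma span_tprod: "cv.span (range tprod) = UNIV"
proof -
  have "t \<in> cv.span (range tprod)" for t :: "'a tensor"
  proof -
    have "free_lift tprod (rep_tensor t) \<in> cv.span (range tprod)"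
      unfolding free_lift_def by (intro cv.span_sum cv.span_scale cv.span_base) auto
    then show ?thesis
      by (simp add: abs_tensor_eq_sum[symmetric] abs_rep_tensor)
  qed
  then show ?thesis by auto
qed

lemma tensor_induct [case_names subspace tprod]:
  assumes "cv.subspace {t. P t}" "\<And>us. P (tprod us)" shows "P t"
proof -
  have "cv.span (range tprod) \<subseteq> {t. P t}"
    using assms by (intro cv.span_minimal) auto
  then show ?thesis by (auto simp: span_tprod)
qed

lemma clinear_eq_subspace: "clinear f \<Longrightarrow> clinear g \<Longrightarrow> cv.subspace {t. f t = g t}"
  by (simp add: cv.subspace_def clinear_0 clinear_add clinear_scale)

lemma tensor_linear_eqI:
  assumes "clinear f" "clinear g" "\<And>us. f (tprod us) = g (tprod us)"
  shows "f t = g t"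
  by (induction t rule: tensor_induct) (use assms clinear_eq_subspace in auto)

lemma multilinear_compose: "clinear h \<Longrightarrow> multilinear f \<Longrightarrow> multilinear (\<lambda>us. h (f us))"
  by (simp add: multilinear_def clinear_iff)

lemma multilinear_prefix: "multilinear f \<Longrightarrow> multilinear (\<lambda>ws. f (us @ ws))"
  unfolding multilinear_def by (simp only: append.assoc[symmetric]) blast

lemma multilinear_suffix: "multilinear f \<Longrightarrow> multilinear (\<lambda>us. f (us @ ws))"
  unfolding multilinear_def by simp

lemma multilinear_lift_param:
  assumes "\<And>vs. multilinear (\<lambda>us. f us vs)"
  shows "multilinear (\<lambda>us. tensor_lift (f us) t)"
proof -
  have "f (us @ (x + y) # ws) = (\<lambda>vs. f (us @ x # ws) vs + f (us @ y # ws) vs)"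
    "f (us @ (c *\<^sub>C x) # ws) = (\<lambda>vs. c *\<^sub>C f (us @ x # ws) vs)" for us ws x y c
    using assms by (auto simp: multilinear_def clinear_iff)
  then show ?thesis
    by (simp add: multilinear_def clinear_iff tensor_lift_fun_linear)
qed

text \<open>The multiplication of the tensor algebra is concatenation of tuples.\<close>

instantiation tensor :: (complex_vector) complex_algebra
begin

definition one_tensor :: "'a tensor"
  where "1 = tprod []"

definition times_tensor :: "'a tensor \<Rightarrow> 'a tensor \<Rightarrow> 'a tensor"
  where "s * t = tensor_lift (\<lambda>us. tensor_lift (\<lambda>vs. tprod (us @ vs)) t) s"

instance
proof
  have lin2: "clinear ((*) s)" for s :: "'a tensor"
  proof -
    have *: "clinear (tensor_lift (\<lambda>vs. tprod (us @ vs)))" for us :: "'a list"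
      by (rule clinear_tensor_lift[OF multilinear_prefix[OF multilinear_tprod]])
    show ?thesis
      unfolding clinear_iff times_tensor_def
      by (simp add: clinear_add[OF *] clinear_scale[OF *] tensor_lift_fun_linear)
  qed
  have ml: "multilinear (\<lambda>us. tensor_lift (\<lambda>vs. tprod (us @ vs)) t)" for t :: "'a tensor"
    by (rule multilinear_lift_param[OF multilinear_suffix[OF multilinear_tprod]])
  have lin1: "clinear (\<lambda>s. s * t)" for t :: "'a tensor"
    unfolding times_tensor_def by (rule clinear_tensor_lift[OF ml])
  have tp: "tprod us * tprod vs = tprod (us @ vs)" for us vs :: "'a list"
    by (simp add: times_tensor_def ml multilinear_prefix[OF multilinear_tprod]
        multilinear_suffix[OF multilinear_tprod])
  fix r s t :: "'a tensor" and a :: complex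
  show "(r + s) * t = r * t + s * t" by (rule clinear_add[OF lin1])
  show "r * (s + t) = r * s + r * t" by (rule clinear_add[OF lin2])
  show "(a *\<^sub>C r) * s = a *\<^sub>C (r * s)" by (rule clinear_scale[OF lin1])
  show "r * (a *\<^sub>C s) = a *\<^sub>C (r * s)" by (rule clinear_scale[OF lin2])
  show "1 * r = r"
    by (rule tensor_linear_eqI[of "\<lambda>r. 1 * r" "\<lambda>r. r", OF lin2])
      (simp_all add: one_tensor_def tp clinear_iff)
  show "r * 1 = r"
    by (rule tensor_linear_eqI[of "\<lambda>r. r * 1" "\<lambda>r. r", OF lin1])
      (simp_all add: one_tensor_def tp clinear_iff)
  have "tprod us * tprod vs * tprod ws = tprod us * (tprod vs * tprod ws)" for us vs ws :: "'a list"
    by (simp add: tp)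
  then have "tprod us * tprod vs * t = tprod us * (tprod vs * t)" for us vs
    by (rule tensor_linear_eqI[of "\<lambda>t. tprod us * tprod vs * t" "\<lambda>t. tprod us * (tprod vs * t)",
          OF lin2 clinear_compose[OF lin2 lin2]])
  then have "tprod us * s * t = tprod us * (s * t)" for us
    by (rule tensor_linear_eqI[of "\<lambda>s. tprod us * s * t" "\<lambda>s. tprod us * (s * t)",
          OF clinear_compose[OF lin1 lin2] clinear_compose[OF lin2 lin1]])
  then show "r * s * t = r * (s * t)"
    by (rule tensor_linear_eqI[of "\<lambda>r. r * s * t" "\<lambda>r. r * (s * t)",
          OF clinear_compose[OF lin1 lin1] lin1])
qed

end

lemma clinear_mult_left: "clinear (\<lambda>x. a * x)" and clinear_mult_right: "clinear (\<lambda>x. x * a)"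
  for a :: "'a::complex_algebra"
  by (simp_all add: clinear_iff mult_scaleC_left mult_scaleC_right algebra_simps)

lemma tprod_mult: "tprod us * tprod vs = tprod (us @ vs)"
  by (simp add: times_tensor_def multilinear_prefix[OF multilinear_tprod]
      multilinear_suffix[OF multilinear_tprod]
      multilinear_lift_param[OF multilinear_suffix[OF multilinear_tprod]])

text \<open>\<open>tensor_map \<phi>\<close> restricts to \<open>\<phi>\<^sup>\<otimes>\<^sup>k\<close> on \<open>k\<close>-th tensor powers.\<close>

definition tensor_map :: "('a::complex_vector \<Rightarrow> 'b::complex_vector) \<Rightarrow> 'a tensor \<Rightarrow> 'b tensor"
  where "tensor_map \<phi> = tensor_lift (\<lambda>us. tprod (map \<phi> us))"

lemma
  assumes "clinear \<phi>"
  shows clinear_tensor_map: "clinear (tensor_map \<phi>)"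
    and tensor_map_tprod: "tensor_map \<phi> (tprod us) = tprod (map \<phi> us)"
proof -
  have "multilinear (\<lambda>us. tprod (map \<phi> us))"
    unfolding multilinear_def
    using clinear_compose[OF multilinearD[OF multilinear_tprod] assms]
    by (simp only: map_append list.map) blast
  then show "clinear (tensor_map \<phi>)" "tensor_map \<phi> (tprod us) = tprod (map \<phi> us)"
    by (simp_all add: tensor_map_def clinear_tensor_lift)
qed

text \<open>
  For bilinear \<open>h\<close>, this sends \<open>(a1 \<otimes> ... \<otimes> ak, b1 \<otimes> ... \<otimes> bk)\<close> to
  \<open>h a1 b1 \<otimes> ... \<otimes> h ak bk\<close>; tensors of different degrees are sent to \<open>0\<close>.
\<close>

definition tensor_map2 ::
  "('a::complex_vector \<Rightarrow> 'b::complex_vector \<Rightarrow> 'c::complex_vector)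
    \<Rightarrow> 'a tensor \<Rightarrow> 'b tensor \<Rightarrow> 'c tensor"
  where "tensor_map2 h s t = tensor_lift (\<lambda>us. tensor_lift
    (\<lambda>vs. if length us = length vs then tprod (map2 h us vs) else 0) t) s"

lemma multilinear_map2:
  assumes "\<And>a. clinear (h a)"
  shows "multilinear (\<lambda>vs. if length us = length vs then tprod (map2 h us vs) else 0)"
  unfolding multilinear_def
proof (intro allI)
  fix vs ws :: "'b list"
  let ?f = "\<lambda>x. if length us = length (vs @ x # ws) then tprod (map2 h us (vs @ x # ws)) else 0"
  show "clinear ?f"
  proof (cases "length us = length vs + Suc (length ws)")
    case True
    then have "length vs < length us" by simp
    then obtain us1 a us2 where us: "us = us1 @ a # us2" "length us1 = length vs"
      using id_take_nth_drop[of "length vs" us] by fastforce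
    have "clinear (\<lambda>x. tprod (map2 h us1 vs @ h a x # map2 h us2 ws))"
      by (rule clinear_compose[OF multilinearD[OF multilinear_tprod] assms])
    then show ?thesis using True us by simp
  qed (simp add: clinear_iff)
qed

lemma multilinear_map2':
  assumes "\<And>b. clinear (\<lambda>a. h a b)"
  shows "multilinear (\<lambda>us. if length us = length vs then tprod (map2 h us vs) else 0)"
proof -
  have "map2 h us vs = map2 (\<lambda>b a. h a b) vs us" for us
    by (subst zip_commute) (simp add: split_def)
  note swap = this
  have "(if length us = length vs then tprod (map2 h us vs) else 0)
      = (if length vs = length us then tprod (map2 (\<lambda>b a. h a b) vs us) else 0)" for us
    by (rule if_cong[OF eq_commute]) (simp_all only: swap)
  then show ?thesis
    using multilinear_map2[of "\<lambda>b a. h a b" vs, OF assms] by (simp only:)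
qed

lemma clinear_tensor_map2_right:
  assumes "\<And>a. clinear (h a)" shows "clinear (tensor_map2 h s)"
proof -
  note lin = clinear_tensor_lift[OF multilinear_map2[of h, OF assms]]
  show ?thesis
    unfolding clinear_iff tensor_map2_def
    by (simp add: clinear_add[OF lin] clinear_scale[OF lin] tensor_lift_fun_linear)
qed

lemma clinear_tensor_map2_left:
  assumes "\<And>b. clinear (\<lambda>a. h a b)" shows "clinear (\<lambda>s. tensor_map2 h s t)"
  unfolding tensor_map2_def
  by (rule clinear_tensor_lift[OF multilinear_lift_param[OF multilinear_map2'[of h, OF assms]]])

lemma tensor_map2_tprod:
  assumes "\<And>a. clinear (h a)" "\<And>b. clinear (\<lambda>a. h a b)"
  shows "tensor_map2 h (tprod us) (tprod vs)
    = (if length us = length vs then tprod (map2 h us vs) else 0)"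
  unfolding tensor_map2_def
  by (simp add: multilinear_lift_param[OF multilinear_map2'[of h, OF assms(2)]]
      multilinear_map2[of h, OF assms(1)] multilinear_map2'[of h, OF assms(2)])

lemma subspace_tensor_power: "cv.subspace (tensor_power k)"
  by (simp add: tensor_power_def)

lemma tprod_in_tensor_power: "length us = k \<Longrightarrow> tprod us \<in> tensor_power k"
  unfolding tensor_power_def by (rule cv.span_base) auto

lemma tensor_map2_in_tensor_power:
  assumes "\<And>a. clinear (h a)" "t \<in> tensor_power k"
  shows "tensor_map2 h s t \<in> tensor_power k"
  using assms(2) unfolding tensor_power_def[where 'a = 'b]
proof (induction rule: cv.span_induct)
  case base
  show ?case
    using clinear_subspace_vimage[OF clinear_tensor_map2_right[of h s, OF assms(1)]
        subspace_tensor_power] by simp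
next
  case (step t)
  then obtain vs where t: "t = tprod vs" "length vs = k" by auto
  show ?case
    unfolding t tensor_map2_def
    by (rule tensor_lift_in_subspace[OF subspace_tensor_power])
      (use t in \<open>simp add: multilinear_map2[of h, OF assms(1)] tprod_in_tensor_power
        cv.subspace_0[OF subspace_tensor_power]\<close>)
qed

text \<open>The multiplication of \<open>A\<^sup>\<otimes>\<^sup>k\<close> for an associative algebra \<open>A\<close>.\<close>

abbreviation tensor_power_mult ::
  "'a::complex_algebra tensor \<Rightarrow> 'a tensor \<Rightarrow> 'a tensor" (infixl \<open>\<odot>\<close> 70)
  where "s \<odot> t \<equiv> tensor_map2 (*) s t"

lemma tensor_power_mult_tprod:
  "tprod us \<odot> tprod vs = (if length us = length vs then tprod (map2 (*) us vs) else 0)"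
  by (rule tensor_map2_tprod[OF clinear_mult_left clinear_mult_right])

lemma clinear_tensor_power_mult: "clinear (\<lambda>t. s \<odot> t)" "clinear (\<lambda>s. s \<odot> t)"
  by (rule clinear_tensor_map2_right[OF clinear_mult_left]
      clinear_tensor_map2_left[OF clinear_mult_right])+

lemma map2_mult_assoc:
  "map2 (*) (map2 (*) us vs) ws = map2 (*) us (map2 (*) vs (ws :: 'a::monoid_mult list))"
  by (rule nth_equalityI) (simp_all add: mult.assoc)

lemma tensor_power_mult_assoc: "(r \<odot> s) \<odot> t = r \<odot> (s \<odot> t)"
proof -
  note lin = clinear_tensor_power_mult
  have "(tprod us \<odot> tprod vs) \<odot> tprod ws = tprod us \<odot> (tprod vs \<odot> tprod ws)"
    for us vs ws :: "'a list"
    by (simp add: tensor_power_mult_tprod map2_mult_assoc clinear_0[OF lin(1)] clinear_0[OF lin(2)])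
  then have "(tprod us \<odot> tprod vs) \<odot> t = tprod us \<odot> (tprod vs \<odot> t)" for us vs
    by (rule tensor_linear_eqI[OF lin(1) clinear_compose[OF lin(1) lin(1)]])
  then have "(tprod us \<odot> s) \<odot> t = tprod us \<odot> (s \<odot> t)" for us
    by (rule tensor_linear_eqI[OF clinear_compose[OF lin(2) lin(1)] clinear_compose[OF lin(1) lin(2)]])
  then show ?thesis
    by (rule tensor_linear_eqI[OF clinear_compose[OF lin(2) lin(2)] lin(2)])
qed

section \<open>The universal enveloping algebra\<close>

definition two_sided_ideal :: "'a::ring set \<Rightarrow> bool"
  where "two_sided_ideal I \<longleftrightarrow>
    0 \<in> I \<and> (\<forall>x\<in>I. \<forall>y\<in>I. x - y \<in> I) \<and> (\<forall>x\<in>I. \<forall>a. a * x \<in> I \<and> x * a \<in> I)"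

definition lie_relations :: "'g::complex_lie_algebra tensor set"
  where "lie_relations =
    {tprod [x] * tprod [y] - tprod [y] * tprod [x] - tprod [lie_bracket x y] | x y. True}"

definition lie_ideal :: "'g::complex_lie_algebra tensor set"
  where "lie_ideal = two_sided_ideal hull lie_relations"

lemma two_sided_ideal_lie_ideal: "two_sided_ideal lie_ideal"
  unfolding lie_ideal_def by (rule hull_in) (auto simp: two_sided_ideal_def)

lemma lie_ideal_zero: "0 \<in> lie_ideal"
  and lie_ideal_diff: "x \<in> lie_ideal \<Longrightarrow> y \<in> lie_ideal \<Longrightarrow> x - y \<in> lie_ideal"
  and lie_ideal_left: "x \<in> lie_ideal \<Longrightarrow> a * x \<in> lie_ideal"
  and lie_ideal_right: "x \<in> lie_ideal \<Longrightarrow> x * a \<in> lie_ideal"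
  using two_sided_ideal_lie_ideal unfolding two_sided_ideal_def by blast+

lemma lie_ideal_minus: "x \<in> lie_ideal \<Longrightarrow> - x \<in> lie_ideal"
  using lie_ideal_diff[OF lie_ideal_zero, of x] by simp

lemma lie_ideal_add: "x \<in> lie_ideal \<Longrightarrow> y \<in> lie_ideal \<Longrightarrow> x + y \<in> lie_ideal"
  using lie_ideal_diff[OF _ lie_ideal_minus, of x y] by simp

lemma lie_ideal_scaleC: "x \<in> lie_ideal \<Longrightarrow> c *\<^sub>C x \<in> lie_ideal"
  using lie_ideal_left[of x "c *\<^sub>C 1"] by (simp add: mult_scaleC_left)

quotient_type (overloaded) 'g uea =
  "'g::complex_lie_algebra tensor" / "\<lambda>s t. s - t \<in> lie_ideal"
proof (rule equivpI)
  show "reflp (\<lambda>s t :: 'g tensor. s - t \<in> lie_ideal)"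
    by (rule reflpI) (simp add: lie_ideal_zero)
  show "symp (\<lambda>s t :: 'g tensor. s - t \<in> lie_ideal)"
    by (rule sympI) (use lie_ideal_minus in fastforce)
  show "transp (\<lambda>s t :: 'g tensor. s - t \<in> lie_ideal)"
    by (rule transpI) (use lie_ideal_add in fastforce)
qed

instantiation uea :: (complex_lie_algebra) complex_algebra
begin
lift_definition zero_uea :: "'a uea" is 0 .
lift_definition one_uea :: "'a uea" is 1 .
lift_definition plus_uea :: "'a uea \<Rightarrow> 'a uea \<Rightarrow> 'a uea" is "(+)"
  by (metis add_diff_add lie_ideal_add)
lift_definition uminus_uea :: "'a uea \<Rightarrow> 'a uea" is uminus
  by (metis lie_ideal_minus minus_diff_minus)
lift_definition minus_uea :: "'a uea \<Rightarrow> 'a uea \<Rightarrow> 'a uea" is "(-)"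
proof -
  fix p q r s :: "'a tensor"
  assume "p - q \<in> lie_ideal" "r - s \<in> lie_ideal"
  then have "(p - q) - (r - s) \<in> lie_ideal" by (rule lie_ideal_diff)
  then show "p - r - (q - s) \<in> lie_ideal" by (simp add: algebra_simps)
qed
lift_definition times_uea :: "'a uea \<Rightarrow> 'a uea \<Rightarrow> 'a uea" is "(*)"
proof -
  fix p q r s :: "'a tensor"
  assume "p - q \<in> lie_ideal" "r - s \<in> lie_ideal"
  then have "(p - q) * r + q * (r - s) \<in> lie_ideal"
    by (intro lie_ideal_add lie_ideal_left lie_ideal_right)
  then show "p * r - q * s \<in> lie_ideal" by (simp add: algebra_simps)
qed
lift_definition scaleC_uea :: "complex \<Rightarrow> 'a uea \<Rightarrow> 'a uea" is "(*\<^sub>C)"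
  by (metis lie_ideal_scaleC cv.scale_right_diff_distrib)
instance
  by standard
    (transfer, simp add: lie_ideal_zero scaleC_add_right scaleC_add_left scaleC_scaleC
      scaleC_one mult_scaleC_left mult_scaleC_right algebra_simps)+
end

lift_definition uea_incl :: "'g::complex_lie_algebra \<Rightarrow> 'g uea" is "\<lambda>x. tprod [x]" .

lemma clinear_abs_uea: "clinear abs_uea"
  by (simp add: clinear_iff plus_uea.abs_eq scaleC_uea.abs_eq)

lemma clinear_uea_incl: "clinear uea_incl"
proof -
  have "clinear (\<lambda>x :: 'a. tprod ([] @ x # []))"
    using multilinear_tprod unfolding multilinear_def by blast
  then have "clinear (\<lambda>x :: 'a. tprod [x])" by simp
  then show ?thesis
    using clinear_compose[OF clinear_abs_uea] by (simp add: uea_incl.abs_eq[abs_def])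
qed

lemma uea_incl_bracket:
  "uea_incl (lie_bracket x y) = uea_incl x * uea_incl y - uea_incl y * uea_incl x"
proof -
  have "tprod [x] * tprod [y] - tprod [y] * tprod [x] - tprod [lie_bracket x y] \<in> lie_ideal"
    unfolding lie_ideal_def by (rule hull_inc) (auto simp: lie_relations_def)
  then have "uea_incl x * uea_incl y - uea_incl y * uea_incl x = uea_incl (lie_bracket x y)"
    by (simp only: uea_incl.abs_eq times_uea.abs_eq minus_uea.abs_eq uea.abs_eq_iff)
  then show ?thesis by simp
qed

lemma abs_uea_tprod: "abs_uea (tprod xs) = prod_list (map uea_incl xs)"
proof (induction xs)
  case Nil
  show ?case by (simp add: one_uea.abs_eq one_tensor_def)
next
  case (Cons x xs)
  have "abs_uea (tprod (x # xs)) = abs_uea (tprod [x] * tprod xs)"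
    by (simp add: tprod_mult)
  then show ?case by (simp add: times_uea.abs_eq[symmetric] Cons uea_incl.abs_eq)
qed

lemma abs_rep_uea: "abs_uea (rep_uea u) = u"
  by (rule Quotient3_abs_rep[OF Quotient3_uea])

lemma uea_linear_eqI:
  assumes "clinear f" "clinear g"
    "\<And>xs. f (prod_list (map uea_incl xs)) = g (prod_list (map uea_incl xs))"
  shows "f u = g u"
proof -
  have "f (abs_uea t) = g (abs_uea t)" for t
    by (rule tensor_linear_eqI[OF clinear_compose[OF assms(1) clinear_abs_uea]
          clinear_compose[OF assms(2) clinear_abs_uea]])
      (simp add: abs_uea_tprod assms(3))
  from this[of "rep_uea u"] show ?thesis
    by (simp only: abs_rep_uea)
qed

text \<open>
  The universal property, for a target with an associative bilinear product \<open>m\<close> and an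
  idempotent \<open>e\<close> that is a unit on the image.
\<close>

lemma uea_universal:
  fixes \<phi> :: "'g::complex_lie_algebra \<Rightarrow> 'b::complex_vector" and m :: "'b \<Rightarrow> 'b \<Rightarrow> 'b"
  assumes m: "\<And>a. clinear (m a)" "\<And>b. clinear (\<lambda>a. m a b)" "\<And>a b c. m (m a b) c = m a (m b c)"
    and e: "m e e = e" "\<And>x. m e (\<phi> x) = \<phi> x" "\<And>x. m (\<phi> x) e = \<phi> x"
    and \<phi>: "clinear \<phi>" "\<And>x y. \<phi> (lie_bracket x y) = m (\<phi> x) (\<phi> y) - m (\<phi> y) (\<phi> x)"
  shows "\<exists>!D. clinear D \<and> D 1 = e \<and> (\<forall>u v. D (u * v) = m (D u) (D v))
    \<and> (\<forall>x. D (uea_incl x) = \<phi> x)"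
proof (rule ex_ex1I)
  define f where "f xs = foldr (\<lambda>x. m (\<phi> x)) xs e" for xs
  define F where "F = tensor_lift f"
  have lin_foldr: "clinear (\<lambda>b. foldr (\<lambda>x. m (\<phi> x)) us b)" for us
  proof (induction us)
    case (Cons x us)
    show ?case using clinear_compose[OF m(1) Cons] by simp
  qed (simp add: clinear_iff)
  have ml: "multilinear f"
    unfolding multilinear_def f_def
    using clinear_compose[OF lin_foldr clinear_compose[OF m(2) \<phi>(1)]] by simp
  have linF: "clinear F" and F_tprod: "F (tprod us) = f us" for us
    using ml by (simp_all add: F_def clinear_tensor_lift)
  have e_f: "m e (f xs) = f xs" for xs
    by (cases xs) (simp_all add: f_def e m(3)[symmetric])
  have f_append: "f (xs @ ys) = m (f xs) (f ys)" for xs ys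
  proof (induction xs)
    case Nil
    show ?case using e_f by (simp add: f_def)
  next
    case (Cons x xs)
    then show ?case by (simp add: f_def m(3))
  qed
  have "F (tprod us * tprod vs) = m (F (tprod us)) (F (tprod vs))" for us vs
    by (simp add: tprod_mult F_tprod f_append)
  then have "F (tprod us * t) = m (F (tprod us)) (F t)" for us t
    by (rule tensor_linear_eqI[OF clinear_compose[OF linF clinear_mult_left]
          clinear_compose[OF m(1) linF]])
  then have F_mult: "F (s * t) = m (F s) (F t)" for s t
    by (rule tensor_linear_eqI[OF clinear_compose[OF linF clinear_mult_right]
          clinear_compose[OF m(2) linF]])
  have F_incl: "F (tprod [x]) = \<phi> x" for x
    by (simp add: F_tprod f_def e)
  have "lie_ideal \<subseteq> {t. F t = 0}"
    unfolding lie_ideal_def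
  proof (rule hull_minimal)
    show "lie_relations \<subseteq> {t. F t = 0}"
      by (auto simp: lie_relations_def clinear_diff[OF linF] F_mult F_incl \<phi>(2))
    show "two_sided_ideal {t. F t = 0}"
      by (auto simp: two_sided_ideal_def clinear_0[OF linF] clinear_diff[OF linF] F_mult
          clinear_0[OF m(1)] clinear_0[OF m(2)])
  qed
  then have "F s = F t" if "s - t \<in> lie_ideal" for s t
    using that clinear_diff[OF linF, of s t] by auto
  moreover have "rep_uea (abs_uea t) - t \<in> lie_ideal" for t :: "'g tensor"
    using abs_rep_uea[of "abs_uea t"] by (simp only: uea.abs_eq_iff)
  ultimately have F_abs: "F (rep_uea (abs_uea t)) = F t" for t
    by blast
  define D where "D u = F (rep_uea u)" for u
  have D_abs: "D (abs_uea t) = F t" for t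
    by (simp add: D_def F_abs)
  have surj: "\<exists>t. u = abs_uea t" for u :: "'g uea"
    by (rule exI[of _ "rep_uea u"]) (simp only: abs_rep_uea)
  have "clinear D"
    unfolding clinear_iff
  proof (intro conjI allI)
    fix u v :: "'g uea" and c
    obtain s t where "u = abs_uea s" "v = abs_uea t" using surj[of u] surj[of v] by blast
    then show "D (u + v) = D u + D v" "D (c *\<^sub>C u) = c *\<^sub>C D u"
      by (simp_all add: plus_uea.abs_eq scaleC_uea.abs_eq D_abs clinear_add[OF linF]
          clinear_scale[OF linF])
  qed
  moreover have "D 1 = e"
    by (simp add: one_uea.abs_eq D_abs one_tensor_def F_tprod f_def)
  moreover have "D (u * v) = m (D u) (D v)" for u v
  proof -
    obtain s t where "u = abs_uea s" "v = abs_uea t" using surj[of u] surj[of v] by blast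
    then show ?thesis by (simp add: times_uea.abs_eq D_abs F_mult)
  qed
  moreover have "D (uea_incl x) = \<phi> x" for x
    by (simp add: uea_incl.abs_eq D_abs F_incl)
  ultimately show "\<exists>D. clinear D \<and> D 1 = e \<and> (\<forall>u v. D (u * v) = m (D u) (D v))
    \<and> (\<forall>x. D (uea_incl x) = \<phi> x)" by blast
next
  fix D D'
  assume D: "clinear D \<and> D 1 = e \<and> (\<forall>u v. D (u * v) = m (D u) (D v))
      \<and> (\<forall>x. D (uea_incl x) = \<phi> x)"
    and D': "clinear D' \<and> D' 1 = e \<and> (\<forall>u v. D' (u * v) = m (D' u) (D' v))
      \<and> (\<forall>x. D' (uea_incl x) = \<phi> x)"
  have "D (prod_list (map uea_incl xs)) = D' (prod_list (map uea_incl xs))" for xs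
    by (induction xs) (use D D' in auto)
  then show "D = D'"
    by (intro ext, rule uea_linear_eqI[OF conjunct1[OF D] conjunct1[OF D']])
qed

section \<open>Counit and coproduct\<close>

definition counit :: "'g::complex_lie_algebra uea \<Rightarrow> complex"
  where "counit = (THE \<epsilon>. algebra_hom \<epsilon> \<and> (\<forall>x. \<epsilon> (uea_incl x) = 0))"

lemma counit_ex1:
  "\<exists>!\<epsilon> :: 'g::complex_lie_algebra uea \<Rightarrow> complex. algebra_hom \<epsilon> \<and> (\<forall>x. \<epsilon> (uea_incl x) = 0)"
proof -
  have "\<exists>!\<epsilon> :: 'g uea \<Rightarrow> complex. clinear \<epsilon> \<and> \<epsilon> 1 = 1 \<and> (\<forall>u v. \<epsilon> (u * v) = \<epsilon> u * \<epsilon> v)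
      \<and> (\<forall>x. \<epsilon> (uea_incl x) = (\<lambda>x. 0) x)"
    by (rule uea_universal[OF clinear_mult_left clinear_mult_right])
      (simp_all add: clinear_iff mult.assoc)
  then show ?thesis
    by (simp add: algebra_hom_def conj_ac cong: conj_cong)
qed

definition is_coproduct :: "('g::complex_lie_algebra uea \<Rightarrow> 'g uea tensor) \<Rightarrow> bool"
  where "is_coproduct D \<longleftrightarrow> clinear D \<and> D 1 = tprod [1, 1]
    \<and> (\<forall>u. D u \<in> tensor_power 2) \<and> (\<forall>u v. D (u * v) = D u \<odot> D v)
    \<and> (\<forall>x. D (uea_incl x) = tprod [uea_incl x, 1] + tprod [1, uea_incl x])"

definition coproduct :: "'g::complex_lie_algebra uea \<Rightarrow> 'g uea tensor"
  where "coproduct = (THE D. is_coproduct D)"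

lemma coproduct_ex1: "\<exists>!D :: 'g::complex_lie_algebra uea \<Rightarrow> 'g uea tensor. is_coproduct D"
proof -
  let ?e = "tprod [1, 1] :: 'g uea tensor"
  let ?\<phi> = "\<lambda>x :: 'g. tprod [uea_incl x, 1] + tprod [1, uea_incl x]"
  let ?P = "\<lambda>D. clinear D \<and> D 1 = ?e \<and> (\<forall>u v. D (u * v) = D u \<odot> D v)
    \<and> (\<forall>x. D (uea_incl x) = ?\<phi> x)"
  note add = clinear_add[OF clinear_tensor_power_mult(1)]
    clinear_add[OF clinear_tensor_power_mult(2)]
  have l1: "clinear (\<lambda>u :: 'g uea. tprod [u, 1])" and l2: "clinear (\<lambda>u :: 'g uea. tprod [1, u])"
    using multilinear_tprod[unfolded multilinear_def, rule_format, of "[]" "[1 :: 'g uea]"]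
      multilinear_tprod[unfolded multilinear_def, rule_format, of "[1 :: 'g uea]" "[]"]
    by simp_all
  have "clinear ?\<phi>"
    using clinear_compose[OF l1 clinear_uea_incl] clinear_compose[OF l2 clinear_uea_incl]
    by (simp add: clinear_iff scaleC_add_right algebra_simps)
  moreover have "?\<phi> (lie_bracket x y) = ?\<phi> x \<odot> ?\<phi> y - ?\<phi> y \<odot> ?\<phi> x" for x y
    by (simp add: add tensor_power_mult_tprod uea_incl_bracket clinear_diff[OF l1]
        clinear_diff[OF l2])
  ultimately have ex1: "\<exists>!D. ?P D"
    by (intro uea_universal[OF clinear_tensor_power_mult tensor_power_mult_assoc])
      (simp_all add: add tensor_power_mult_tprod)
  have range: "D u \<in> tensor_power 2" if D: "?P D" for D u
  proof -
    have word: "D (prod_list (map uea_incl xs)) \<in> tensor_power 2" for xs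
    proof (induction xs)
      case Nil
      show ?case using D by (simp add: tprod_in_tensor_power)
    next
      case (Cons x xs)
      then show ?case
        using D by (simp add: tensor_map2_in_tensor_power[OF clinear_mult_left])
    qed
    have "cv.subspace {t. D (abs_uea t) \<in> tensor_power 2}"
      using clinear_subspace_vimage[OF clinear_compose[OF _ clinear_abs_uea]
          subspace_tensor_power] D by blast
    then have "D (abs_uea t) \<in> tensor_power 2" for t
      by (rule tensor_induct) (simp add: abs_uea_tprod word)
    from this[of "rep_uea u"] show ?thesis
      by (simp only: abs_rep_uea)
  qed
  have "is_coproduct D \<longleftrightarrow> ?P D" for D
    using range[of D] unfolding is_coproduct_def by blast
  then show ?thesis using ex1 by simp
qed

lemma algebra_hom_counit: "algebra_hom counit" and counit_uea_incl: "counit (uea_incl x) = 0"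
  using theI'[OF counit_ex1] unfolding counit_def by blast+

lemma is_coproduct_coproduct: "is_coproduct coproduct"
  unfolding coproduct_def by (rule theI'[OF coproduct_ex1])

text \<open>On the \<open>k\<close>-th tensor power with \<open>k > 0\<close> this is \<open>id\<^sup>\<otimes>\<^sup>(\<^sup>k\<^sup>-\<^sup>1\<^sup>) \<otimes> D\<close>.\<close>

definition apply_last ::
  "('a::complex_vector \<Rightarrow> 'a tensor) \<Rightarrow> 'a tensor \<Rightarrow> 'a tensor"
  where "apply_last D = tensor_lift (\<lambda>us. tprod (butlast us) * D (last us))"

lemma apply_last_tprod:
  assumes "clinear D" "us \<noteq> []"
  shows "apply_last D (tprod us) = tprod (butlast us) * D (last us)"
proof -
  have "clinear (\<lambda>x. tprod (butlast (us @ x # ws)) * D (last (us @ x # ws)))" for us ws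
  proof (cases "ws = []")
    case True
    then show ?thesis using clinear_compose[OF clinear_mult_left assms(1)] by simp
  next
    case False
    have "clinear (\<lambda>x :: 'a. tprod (us @ x # butlast ws))"
      using multilinear_tprod unfolding multilinear_def by blast
    from clinear_compose[OF clinear_mult_right this] False show ?thesis
      by (simp add: butlast_append)
  qed
  then have "multilinear (\<lambda>us. tprod (butlast us) * D (last us))"
    by (simp add: multilinear_def)
  then show ?thesis by (simp add: apply_last_def)
qed

primrec iterated_coproduct :: "nat \<Rightarrow> 'g::complex_lie_algebra uea \<Rightarrow> 'g uea tensor"
  where
    "iterated_coproduct 0 u = tprod [u]"
  | "iterated_coproduct (Suc k) u = apply_last coproduct (iterated_coproduct k u)"

section \<open>The algebra of families of endomorphisms of all tensor powers\<close>

definition tensor_power_End :: "nat \<Rightarrow> ('v::complex_vector tensor \<Rightarrow> 'v tensor) set"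
  where "tensor_power_End k = {f \<in> tensor_power k \<rightarrow>\<^sub>E tensor_power k.
    (\<forall>x\<in>tensor_power k. \<forall>y\<in>tensor_power k. f (x + y) = f x + f y)
    \<and> (\<forall>c. \<forall>x\<in>tensor_power k. f (c *\<^sub>C x) = c *\<^sub>C f x)}"

lemma tensor_power_closed:
  "0 \<in> tensor_power k"
  "x \<in> tensor_power k \<Longrightarrow> y \<in> tensor_power k \<Longrightarrow> x + y \<in> tensor_power k"
  "x \<in> tensor_power k \<Longrightarrow> y \<in> tensor_power k \<Longrightarrow> x - y \<in> tensor_power k"
  "x \<in> tensor_power k \<Longrightarrow> - x \<in> tensor_power k"
  "x \<in> tensor_power k \<Longrightarrow> c *\<^sub>C x \<in> tensor_power k"
  by (simp_all add: subspace_tensor_power cv.subspace_0 cv.subspace_add cv.subspace_diff cv.subspace_neg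
      cv.subspace_scale)

lemma restrict_in_tensor_power_End:
  assumes "\<And>x. x \<in> tensor_power k \<Longrightarrow> f x \<in> tensor_power k"
    "\<And>x y. x \<in> tensor_power k \<Longrightarrow> y \<in> tensor_power k \<Longrightarrow> f (x + y) = f x + f y"
    "\<And>c x. x \<in> tensor_power k \<Longrightarrow> f (c *\<^sub>C x) = c *\<^sub>C f x"
  shows "restrict f (tensor_power k) \<in> tensor_power_End k"
  using assms by (auto simp: tensor_power_End_def tensor_power_closed)

lemma tensor_power_EndD:
  assumes "f \<in> tensor_power_End k"
  shows "x \<in> tensor_power k \<Longrightarrow> f x \<in> tensor_power k"
    "x \<in> tensor_power k \<Longrightarrow> y \<in> tensor_power k \<Longrightarrow> f (x + y) = f x + f y"
    "x \<in> tensor_power k \<Longrightarrow> f (c *\<^sub>C x) = c *\<^sub>C f x"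
    "x \<notin> tensor_power k \<Longrightarrow> f x = undefined"
proof -
  note f = assms[unfolded tensor_power_End_def mem_Collect_eq]
  note f = conjunct1[OF f] conjunct1[OF conjunct2[OF f]] conjunct2[OF conjunct2[OF f]]
  show "f x \<in> tensor_power k" if "x \<in> tensor_power k"
    using f(1) that by (rule PiE_mem)
  show "f (x + y) = f x + f y" if "x \<in> tensor_power k" "y \<in> tensor_power k"
    using f(2) that by blast
  show "f (c *\<^sub>C x) = c *\<^sub>C f x" if "x \<in> tensor_power k"
    using f(3) that by blast
  show "f x = undefined" if "x \<notin> tensor_power k"
    using f(1) that by (rule PiE_arb)
qed

typedef (overloaded) 'v tensor_power_End_prod =
  "{F :: nat \<Rightarrow> 'v::complex_vector tensor \<Rightarrow> 'v tensor. \<forall>k. F k \<in> tensor_power_End k}"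
  morphisms End_component Abs_tensor_power_End_prod
proof -
  have "restrict (\<lambda>x. x) (tensor_power k) \<in> tensor_power_End k" for k
    by (rule restrict_in_tensor_power_End) auto
  then show ?thesis
    by (intro exI[of _ "\<lambda>k. restrict (\<lambda>x. x) (tensor_power k)"] CollectI allI)
qed

setup_lifting type_definition_tensor_power_End_prod

lemma tensor_power_End_familyD:
  assumes "\<And>k. F k \<in> tensor_power_End k"
  shows "x \<in> tensor_power k \<Longrightarrow> F k x \<in> tensor_power k"
    "x \<in> tensor_power k \<Longrightarrow> y \<in> tensor_power k \<Longrightarrow> F k (x + y) = F k x + F k y"
    "x \<in> tensor_power k \<Longrightarrow> F k (c *\<^sub>C x) = c *\<^sub>C F k x"
    "x \<notin> tensor_power k \<Longrightarrow> F k x = undefined"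
  by (rule tensor_power_EndD[OF assms]; assumption)+

instantiation tensor_power_End_prod :: (complex_vector) complex_algebra
begin
lift_definition zero_tensor_power_End_prod :: "'a tensor_power_End_prod"
  is "\<lambda>k. \<lambda>x\<in>tensor_power k. 0"
  by (rule restrict_in_tensor_power_End) (auto simp: tensor_power_closed)
lift_definition one_tensor_power_End_prod :: "'a tensor_power_End_prod"
  is "\<lambda>k. \<lambda>x\<in>tensor_power k. x"
  by (rule restrict_in_tensor_power_End) auto
lift_definition plus_tensor_power_End_prod ::
  "'a tensor_power_End_prod \<Rightarrow> 'a tensor_power_End_prod \<Rightarrow> 'a tensor_power_End_prod"
  is "\<lambda>F G k. \<lambda>x\<in>tensor_power k. F k x + G k x"
  by (rule restrict_in_tensor_power_End)
    (auto simp: tensor_power_closed tensor_power_End_familyD scaleC_add_right algebra_simps)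
lift_definition uminus_tensor_power_End_prod ::
  "'a tensor_power_End_prod \<Rightarrow> 'a tensor_power_End_prod"
  is "\<lambda>F k. \<lambda>x\<in>tensor_power k. - F k x"
  by (rule restrict_in_tensor_power_End) (auto simp: tensor_power_closed tensor_power_End_familyD)
lift_definition minus_tensor_power_End_prod ::
  "'a tensor_power_End_prod \<Rightarrow> 'a tensor_power_End_prod \<Rightarrow> 'a tensor_power_End_prod"
  is "\<lambda>F G k. \<lambda>x\<in>tensor_power k. F k x - G k x"
  by (rule restrict_in_tensor_power_End)
    (auto simp: tensor_power_closed tensor_power_End_familyD cv.scale_right_diff_distrib algebra_simps)
lift_definition times_tensor_power_End_prod ::
  "'a tensor_power_End_prod \<Rightarrow> 'a tensor_power_End_prod \<Rightarrow> 'a tensor_power_End_prod"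
  is "\<lambda>F G k. \<lambda>x\<in>tensor_power k. F k (G k x)"
  by (rule restrict_in_tensor_power_End) (auto simp: tensor_power_closed tensor_power_End_familyD)
lift_definition scaleC_tensor_power_End_prod ::
  "complex \<Rightarrow> 'a tensor_power_End_prod \<Rightarrow> 'a tensor_power_End_prod"
  is "\<lambda>c F k. \<lambda>x\<in>tensor_power k. c *\<^sub>C F k x"
  by (rule restrict_in_tensor_power_End)
    (auto simp: tensor_power_closed tensor_power_End_familyD scaleC_add_right scaleC_scaleC mult.commute)
instance
  by standard
    (transfer, auto intro!: ext simp: restrict_def tensor_power_closed tensor_power_End_familyD
      scaleC_add_right scaleC_add_left scaleC_scaleC scaleC_one algebra_simps)+
end

section \<open>The maps \<open>\<pi>\<^sub>n\<close> and \<open>\<Psi>\<close>\<close>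

text \<open>
  \<open>tensor_map2 endo_apply\<close> is the action of \<open>End(V)\<^sup>\<otimes>\<^sup>n\<close> on \<open>V\<^sup>\<otimes>\<^sup>n\<close>, that is, the
  inclusion of \<open>End(V)\<^sup>\<otimes>\<^sup>n\<close> into \<open>End(V\<^sup>\<otimes>\<^sup>n)\<close>.  For \<open>n = 0\<close>, complex numbers
  act on the line \<open>V\<^sup>\<otimes>\<^sup>0\<close> by scaling.
\<close>

definition rep_power ::
  "('g::complex_lie_algebra uea \<Rightarrow> 'v::complex_vector endo) \<Rightarrow> nat \<Rightarrow> 'g uea
    \<Rightarrow> 'v tensor \<Rightarrow> 'v tensor"
  where "rep_power \<pi> n u =
    (if n = 0 then (\<lambda>x\<in>tensor_power 0. counit u *\<^sub>C x)
     else (\<lambda>x\<in>tensor_power n.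
       tensor_map2 endo_apply (tensor_map \<pi> (iterated_coproduct (n - 1) u)) x))"

lemma rep_power_in_tensor_power_End:
  fixes \<pi> :: "'g::complex_lie_algebra uea \<Rightarrow> 'v::complex_vector endo"
  shows "rep_power \<pi> n u \<in> tensor_power_End n"
proof (cases "n = 0")
  case True
  have "(\<lambda>x\<in>tensor_power 0. counit u *\<^sub>C x) \<in> tensor_power_End 0"
    by (rule restrict_in_tensor_power_End)
      (auto simp: tensor_power_closed scaleC_add_right scaleC_scaleC mult.commute)
  with True show ?thesis by (simp add: rep_power_def)
next
  case False
  have "(\<lambda>x\<in>tensor_power n. tensor_map2 endo_apply s x) \<in> tensor_power_End n"
    for s :: "'v endo tensor"
    using clinear_tensor_map2_right[of endo_apply s, OF clinear_endo_apply]
    by (intro restrict_in_tensor_power_End)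
      (auto simp: clinear_iff tensor_map2_in_tensor_power[OF clinear_endo_apply])
  with False show ?thesis by (simp add: rep_power_def)
qed

lift_definition Psi ::
  "('g::complex_lie_algebra uea \<Rightarrow> 'v::complex_vector endo) \<Rightarrow> 'g uea \<Rightarrow> 'v tensor_power_End_prod"
  is "\<lambda>\<pi> u n. rep_power \<pi> n u"
  by (rule rep_power_in_tensor_power_End)

end

theory Submission
  imports Defs "HOL-Library.Multiset" "HOL-Computational_Algebra.Polynomial"
begin

text \<open>
  Injectivity needs only the spanning half of the Poincare-Birkhoff-Witt theorem.  Choose \<open>z\<close> in
  the Lie algebra with \<open>\<pi> z = 1\<close> (it is central, by faithfulness), or \<open>z = 0\<close> if there is none,
  and a complement of the line through \<open>z\<close> with basis \<open>B\<close>.  Modulo terms of lower degree in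
  \<open>B\<close>, an element \<open>u\<close> of degree at most \<open>n\<close> is a sum of \<open>p\<^sub>\<alpha>(z) e\<^sup>\<alpha>\<close> over multisets \<open>\<alpha>\<close> of
  size \<open>n\<close> in \<open>B\<close>.  For \<open>k > n\<close>, pair \<open>\<pi>\<^sub>k u\<close> with a product of \<open>k\<close> functionals: \<open>n\<close> of them
  vanish at \<open>1\<close> and are dual to the letters of a fixed \<open>\<beta>\<close>, the other ones are \<open>1\<close> at \<open>1\<close>.  Each
  letter of a word acts in one slot only, so all terms of lower degree and all \<open>\<alpha> \<noteq> \<beta>\<close> die, and
  what remains is a positive multiple of \<open>p\<^sub>\<beta>(k)\<close> (of \<open>p\<^sub>\<beta>(0)\<close> if \<open>z = 0\<close>).  If \<open>\<pi>\<^sub>k u = 0\<close> for all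
  \<open>k\<close>, then \<open>p\<^sub>\<beta>\<close> has infinitely many zeros, so \<open>u\<close> has degree less than \<open>n\<close>.
  As \<open>V\<close> may be infinite-dimensional, the functionals on \<open>End(V)\<close> are taken to be linear
  combinations of matrix coefficients, which can be evaluated through the action on \<open>V\<^sup>\<otimes>\<^sup>k\<close>.
\<close>

section \<open>Multiplicativity of the maps \<open>\<pi>\<^sub>n\<close>\<close>

lemma tensor_power_linear_eqI:
  assumes "clinear f" "clinear g" "\<And>us. length us = k \<Longrightarrow> f (tprod us) = g (tprod us)"
    and "t \<in> tensor_power k"
  shows "f t = g t"
  using assms(4) unfolding tensor_power_def
proof (induction rule: cv.span_induct)
  case base
  show ?case by (rule clinear_eq_subspace[OF assms(1,2)])
qed (use assms(3) in auto)

text \<open>The interchange law for slotwise product and concatenation. The degrees make both words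
  break at the same place; otherwise the total lengths could agree while the pieces do not, and only
  the right side would vanish. Linearity frees one argument at a time from being a pure
  tensor.\<close>

lemma tensor_power_mult_concat:
  assumes s: "s \<in> tensor_power p" and s': "s' \<in> tensor_power p"
    and t: "t \<in> tensor_power q" and t': "t' \<in> tensor_power q"
  shows "(s * t) \<odot> (s' * t') = (s \<odot> s') * (t \<odot> t')"
proof -
  note lin = clinear_tensor_power_mult clinear_mult_left clinear_mult_right
  have 1: "(tprod us * tprod vs) \<odot> (tprod us' * tprod vs')
      = (tprod us \<odot> tprod us') * (tprod vs \<odot> tprod vs')"
    if "length us = p" "length us' = p" "length vs = q" "length vs' = q" for us us' vs vs' :: "'a list"
    using that by (simp add: tprod_mult tensor_power_mult_tprod)
  have 2: "(tprod us * tprod vs) \<odot> (tprod us' * t')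
      = (tprod us \<odot> tprod us') * (tprod vs \<odot> t')"
    if "length us = p" "length us' = p" "length vs = q" for us us' vs
    by (rule tensor_power_linear_eqI[OF _ _ _ t', of "\<lambda>t'. (tprod us * tprod vs) \<odot> (tprod us' * t')"])
      (use that 1 in \<open>auto intro!: clinear_compose[OF lin(1)] clinear_compose[OF lin(3)]
        lin(1) lin(3)\<close>)
  have 3: "(tprod us * t) \<odot> (tprod us' * t') = (tprod us \<odot> tprod us') * (t \<odot> t')"
    if "length us = p" "length us' = p" for us us'
    by (rule tensor_power_linear_eqI[OF _ _ _ t, of "\<lambda>t. (tprod us * t) \<odot> (tprod us' * t')"])
      (use that 2 in \<open>auto intro!: clinear_compose[OF lin(2)] clinear_compose[OF lin(3)]
        lin(2) lin(3)\<close>)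
  have 4: "(tprod us * t) \<odot> (s' * t') = (tprod us \<odot> s') * (t \<odot> t')"
    if "length us = p" for us
    by (rule tensor_power_linear_eqI[OF _ _ _ s', of "\<lambda>s'. (tprod us * t) \<odot> (s' * t')"])
      (use that 3 in \<open>auto intro!: clinear_compose[OF lin(1)] clinear_compose[OF lin(4)]
        lin(1) lin(4)\<close>)
  show ?thesis
    by (rule tensor_power_linear_eqI[OF _ _ _ s, of "\<lambda>s. (s * t) \<odot> (s' * t')"])
      (use 4 in \<open>auto intro!: clinear_compose[OF lin(2)] clinear_compose[OF lin(4)]
        lin(2) lin(4)\<close>)
qed

lemma tensor_power_mult_closed:
  assumes "s \<in> tensor_power p" "t \<in> tensor_power q"
  shows "s * t \<in> tensor_power (p + q)"
proof -
  have "tprod us * t \<in> tensor_power (p + q)" if "length us = p" for us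
    using assms(2) unfolding tensor_power_def[where k = q]
  proof (induction rule: cv.span_induct)
    case base
    show ?case by (rule clinear_subspace_vimage[OF clinear_mult_left subspace_tensor_power])
  qed (use that in \<open>auto simp: tprod_mult intro!: tprod_in_tensor_power\<close>)
  note 1 = this
  show ?thesis
    using assms(1) unfolding tensor_power_def[where k = p]
  proof (induction rule: cv.span_induct)
    case base
    show ?case by (rule clinear_subspace_vimage[OF clinear_mult_right subspace_tensor_power])
  qed (use 1 in auto)
qed

text \<open>The varied entry is either the last one and enters through \<open>D\<close>, or it
  enters through \<open>tprod\<close>. The empty tuple, with its unspecified \<open>last\<close>, is
  never of the form \<open>us @ x # ws\<close>.\<close>

lemma multilinear_apply_last:
  assumes "clinear D"
  shows "multilinear (\<lambda>us. tprod (butlast us) * D (last us))"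
  unfolding multilinear_def
proof (intro allI)
  fix us ws
  show "clinear (\<lambda>x. tprod (butlast (us @ x # ws)) * D (last (us @ x # ws)))"
  proof (cases "ws = []")
    case True
    then show ?thesis using clinear_compose[OF clinear_mult_left assms] by simp
  next
    case False
    with clinear_compose[OF clinear_mult_right multilinearD[OF multilinear_tprod]]
    show ?thesis by (simp add: butlast_append)
  qed
qed

lemma clinear_apply_last: "clinear D \<Longrightarrow> clinear (apply_last D)"
  unfolding apply_last_def by (rule clinear_tensor_lift[OF multilinear_apply_last])

lemma apply_last_in_tensor_power:
  assumes "clinear D" "\<And>u. D u \<in> tensor_power 2" "t \<in> tensor_power (Suc k)"
  shows "apply_last D t \<in> tensor_power (Suc (Suc k))"
  using assms(3) unfolding tensor_power_def[where k = "Suc k"]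
proof (induction rule: cv.span_induct)
  case base
  show ?case by (rule clinear_subspace_vimage[OF clinear_apply_last[OF assms(1)] subspace_tensor_power])
next
  case (step t)
  then obtain us where us: "t = tprod us" "length us = Suc k" by auto
  then have "us \<noteq> []" by auto
  moreover have "tprod (butlast us) * D (last us) \<in> tensor_power (k + 2)"
    by (rule tensor_power_mult_closed) (use us assms(2) in \<open>auto intro: tprod_in_tensor_power\<close>)
  ultimately show ?case using us by (simp add: apply_last_tprod[OF assms(1)])
qed

lemma map2_butlast_last:
  assumes "length us = length vs" "us \<noteq> []"
  shows "butlast (map2 f us vs) = map2 f (butlast us) (butlast vs)"
    "last (map2 f us vs) = f (last us) (last vs)"
proof -
  have vs: "vs \<noteq> []" using assms by auto
  show "butlast (map2 f us vs) = map2 f (butlast us) (butlast vs)"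
    using assms by (simp add: butlast_conv_take take_map take_zip)
  show "last (map2 f us vs) = f (last us) (last vs)"
    using assms vs by (simp add: last_conv_nth)
qed

text \<open>By \<open>tensor_power_mult_concat\<close> the leading slots and the image of the last
  slot multiply separately. Degree \<open>Suc k\<close> excludes the empty tuple.\<close>

lemma apply_last_mult:
  assumes D: "clinear D" "\<And>u. D u \<in> tensor_power 2" "\<And>u v. D (u * v) = D u \<odot> D v"
    and s: "s \<in> tensor_power (Suc k)" and t: "t \<in> tensor_power (Suc k)"
  shows "apply_last D (s \<odot> t) = apply_last D s \<odot> apply_last D t"
proof -
  note lin = clinear_tensor_power_mult clinear_apply_last[OF D(1)]
  have 1: "apply_last D (tprod us \<odot> tprod vs) = apply_last D (tprod us) \<odot> apply_last D (tprod vs)"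
    if "length us = Suc k" "length vs = Suc k" for us vs
  proof -
    have ne: "us \<noteq> []" "vs \<noteq> []" "map2 (*) us vs \<noteq> []" using that by (auto simp flip: length_0_conv)
    have "tprod (butlast us) \<in> tensor_power k" "tprod (butlast vs) \<in> tensor_power k"
      using that by (auto intro: tprod_in_tensor_power)
    note * = tensor_power_mult_concat[OF this D(2) D(2)]
    show ?thesis
      using that ne by (simp add: tensor_power_mult_tprod apply_last_tprod[OF D(1)] map2_butlast_last
          D(3) *)
  qed
  have 2: "apply_last D (tprod us \<odot> t) = apply_last D (tprod us) \<odot> apply_last D t"
    if "length us = Suc k" for us
    by (rule tensor_power_linear_eqI[OF _ _ _ t])
      (use 1 that in \<open>auto intro!: clinear_compose[OF lin(1)] clinear_compose[OF lin(3)] lin\<close>)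
  show ?thesis
    by (rule tensor_power_linear_eqI[OF _ _ _ s])
      (use 2 in \<open>auto intro!: clinear_compose[OF lin(2)] clinear_compose[OF lin(3)] lin\<close>)
qed

section \<open>The iterated coproduct as a multiplicative map\<close>

lemma
  shows clinear_coproduct: "clinear coproduct"
    and coproduct_1: "coproduct 1 = tprod [1, 1]"
    and coproduct_in_tensor_power: "coproduct u \<in> tensor_power 2"
    and coproduct_mult: "coproduct (u * v) = coproduct u \<odot> coproduct v"
    and coproduct_uea_incl:
      "coproduct (uea_incl x) = tprod [uea_incl x, 1] + tprod [1, uea_incl x]"
  using is_coproduct_coproduct unfolding is_coproduct_def by blast+

lemma clinear_iterated_coproduct: "clinear (iterated_coproduct k)"
proof (induction k)
  case 0
  show ?case using multilinearD[OF multilinear_tprod, of "[]" "[]"] by simp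
next
  case (Suc k)
  show ?case using clinear_compose[OF clinear_apply_last[OF clinear_coproduct] Suc] by simp
qed

lemma iterated_coproduct_in_tensor_power: "iterated_coproduct k u \<in> tensor_power (Suc k)"
proof (induction k)
  case 0
  show ?case by (simp add: tprod_in_tensor_power)
next
  case (Suc k)
  then show ?case
    by (simp add: apply_last_in_tensor_power[OF clinear_coproduct coproduct_in_tensor_power])
qed

lemma iterated_coproduct_mult:
  "iterated_coproduct k (u * v) = iterated_coproduct k u \<odot> iterated_coproduct k v"
proof (induction k)
  case 0
  show ?case by (simp add: tensor_power_mult_tprod)
next
  case (Suc k)
  then show ?case
    by (simp add: apply_last_mult[OF clinear_coproduct coproduct_in_tensor_power coproduct_mult
          iterated_coproduct_in_tensor_power iterated_coproduct_in_tensor_power])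
qed

lemma iterated_coproduct_1: "iterated_coproduct k 1 = tprod (replicate (Suc k) 1)"
proof (induction k)
  case (Suc k)
  have "butlast (replicate (Suc k) 1) @ [1, 1] = (replicate (Suc (Suc k)) 1 :: 'a uea list)"
    by (simp add: butlast_conv_take replicate_append_same[symmetric])
  then show ?case
    using Suc by (simp add: apply_last_tprod[OF clinear_coproduct] coproduct_1 tprod_mult
        del: replicate_Suc)
qed simp

text \<open>Elements of the Lie algebra are primitive: at each step only the summand with
  \<open>x\<close> in the last slot branches, while all others gain a trailing 1.\<close>

lemma iterated_coproduct_uea_incl:
  "iterated_coproduct k (uea_incl x)
    = (\<Sum>j\<le>k. tprod ((replicate (Suc k) 1)[j := uea_incl x]))"
proof (induction k)
  case (Suc k)
  note lin = clinear_apply_last[OF clinear_coproduct]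
  have *: "apply_last coproduct (tprod ((replicate (Suc k) 1)[j := uea_incl x]))
    = tprod ((replicate (Suc (Suc k)) 1)[j := uea_incl x])" if "j < k" for j
  proof -
    have ne: "(replicate (Suc k) 1)[j := uea_incl x] \<noteq> []" by (simp del: replicate_Suc)
    have "butlast ((replicate (Suc k) 1)[j := uea_incl x]) @ [1, 1]
        = (replicate (Suc (Suc k)) 1)[j := uea_incl x]"
      by (rule nth_equalityI)
        (use that in \<open>auto simp: nth_append butlast_conv_take nth_list_update nth_Cons' simp del: replicate_Suc\<close>)
    moreover have "last ((replicate (Suc k) 1)[j := uea_incl x]) = 1"
      using that ne by (simp add: last_conv_nth nth_list_update del: replicate_Suc)
    ultimately show ?thesis
      using ne by (simp add: apply_last_tprod[OF clinear_coproduct] coproduct_1 tprod_mult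
          del: replicate_Suc)
  qed
  have k: "(replicate (Suc k) 1)[k := uea_incl x] = replicate k 1 @ [uea_incl x]"
    by (rule nth_equalityI) (auto simp: nth_append nth_list_update simp del: replicate_Suc)
  have "apply_last coproduct (tprod ((replicate (Suc k) 1)[k := uea_incl x]))
    = tprod (replicate k 1 @ [uea_incl x, 1]) + tprod (replicate k 1 @ [1, uea_incl x])"
    unfolding k
    by (simp add: apply_last_tprod[OF clinear_coproduct] coproduct_uea_incl tprod_mult algebra_simps)
  also have "replicate k 1 @ [uea_incl x, 1] = (replicate (Suc (Suc k)) 1)[k := uea_incl x]"
    by (rule nth_equalityI) (auto simp: nth_append nth_list_update nth_Cons'
        simp del: replicate_Suc)
  also have "replicate k 1 @ [1, uea_incl x] = (replicate (Suc (Suc k)) 1)[Suc k := uea_incl x]"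
    by (rule nth_equalityI) (auto simp: nth_append nth_list_update nth_Cons'
        simp del: replicate_Suc)
  finally have 2: "apply_last coproduct (tprod ((replicate (Suc k) 1)[k := uea_incl x]))
    = tprod ((replicate (Suc (Suc k)) 1)[k := uea_incl x])
      + tprod ((replicate (Suc (Suc k)) 1)[Suc k := uea_incl x])" .
  have "iterated_coproduct (Suc k) (uea_incl x)
    = (\<Sum>j<k. apply_last coproduct (tprod ((replicate (Suc k) 1)[j := uea_incl x])))
      + apply_last coproduct (tprod ((replicate (Suc k) 1)[k := uea_incl x]))"
    by (simp add: Suc clinear_add[OF lin] clinear_sum[OF lin] lessThan_Suc_atMost[symmetric]
        del: replicate_Suc)
  also have "\<dots> = (\<Sum>j<k. tprod ((replicate (Suc (Suc k)) 1)[j := uea_incl x]))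
      + (tprod ((replicate (Suc (Suc k)) 1)[k := uea_incl x])
      + tprod ((replicate (Suc (Suc k)) 1)[Suc k := uea_incl x]))"
    unfolding 2 by (simp add: * del: replicate_Suc)
  also have "\<dots> = (\<Sum>j\<le>Suc k. tprod ((replicate (Suc (Suc k)) 1)[j := uea_incl x]))"
    by (simp add: lessThan_Suc_atMost[symmetric] add.assoc del: replicate_Suc)
  finally show ?case .
qed simp

lemma tensor_map_mult:
  assumes "clinear \<phi>" "\<And>u v. \<phi> (u * v) = \<phi> u * \<phi> v"
  shows "tensor_map \<phi> (s \<odot> t) = tensor_map \<phi> s \<odot> tensor_map \<phi> t"
proof -
  note lin = clinear_tensor_power_mult clinear_tensor_map[OF assms(1)]
  have m: "map \<phi> (map2 (*) us vs) = map2 (*) (map \<phi> us) (map \<phi> vs)" for us vs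
    by (simp add: map2_map_map zip_map_map assms(2) split_def)
  have 1: "tensor_map \<phi> (tprod us \<odot> tprod vs) = tensor_map \<phi> (tprod us) \<odot> tensor_map \<phi> (tprod vs)"
    for us vs
    by (simp add: tensor_power_mult_tprod tensor_map_tprod[OF assms(1)] clinear_0[OF lin(3)] m
        del: map_map)
  have 2: "tensor_map \<phi> (tprod us \<odot> t) = tensor_map \<phi> (tprod us) \<odot> tensor_map \<phi> t" for us
    by (rule tensor_linear_eqI[OF clinear_compose[OF lin(3,1)] clinear_compose[OF lin(1,3)] 1])
  show ?thesis
    by (rule tensor_linear_eqI[OF clinear_compose[OF lin(3,2)] clinear_compose[OF lin(2,3)] 2])
qed

section \<open>The action of tensor powers of \<open>End(V)\<close> on tensor powers of
  \<open>V\<close>\<close>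

lemma clinear_endo_apply_left: "clinear (\<lambda>a. endo_apply a v)"
  by (simp add: clinear_iff plus_endo.rep_eq scaleC_endo.rep_eq)

abbreviation tensor_action :: "'v::complex_vector endo tensor \<Rightarrow> 'v tensor \<Rightarrow> 'v tensor"
  where "tensor_action \<equiv> tensor_map2 endo_apply"

lemma clinear_tensor_action: "clinear (tensor_action s)" "clinear (\<lambda>s. tensor_action s x)"
  by (rule clinear_tensor_map2_right[OF clinear_endo_apply]
      clinear_tensor_map2_left[OF clinear_endo_apply_left])+

lemma tensor_action_tprod:
  "tensor_action (tprod as) (tprod vs)
    = (if length as = length vs then tprod (map2 endo_apply as vs) else 0)"
  by (rule tensor_map2_tprod[OF clinear_endo_apply clinear_endo_apply_left])

lemma tensor_action_mult: "tensor_action (s \<odot> t) x = tensor_action s (tensor_action t x)"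
proof -
  note lin = clinear_tensor_action clinear_tensor_power_mult
  have m: "map2 endo_apply (map2 (*) as bs) vs = map2 endo_apply as (map2 endo_apply bs vs)"
    for as bs :: "'a endo list" and vs
    by (rule nth_equalityI) (simp_all add: times_endo.rep_eq)
  have 1: "tensor_action (tprod as \<odot> tprod bs) (tprod vs)
    = tensor_action (tprod as) (tensor_action (tprod bs) (tprod vs))" for as bs :: "'a endo list" and vs
    by (simp add: tensor_power_mult_tprod tensor_action_tprod m clinear_0[OF lin(1)] clinear_0[OF lin(2)])
  have 2: "tensor_action (tprod as \<odot> tprod bs) x
    = tensor_action (tprod as) (tensor_action (tprod bs) x)" for as bs
    by (rule tensor_linear_eqI[OF lin(1) clinear_compose[OF lin(1,1)] 1])
  have 3: "tensor_action (tprod as \<odot> t) x = tensor_action (tprod as) (tensor_action t x)" for as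
    by (rule tensor_linear_eqI[OF clinear_compose[OF lin(2,3)] clinear_compose[OF lin(1,2)] 2])
  show ?thesis
    by (rule tensor_linear_eqI[OF clinear_compose[OF lin(2,4)] lin(2) 3])
qed

lemma tensor_action_1:
  assumes "x \<in> tensor_power k"
  shows "tensor_action (tprod (replicate k 1)) x = x"
proof (rule tensor_power_linear_eqI[OF clinear_tensor_action(1) _ _ assms, of "\<lambda>x. x"])
  fix vs :: "'a list" assume "length vs = k"
  moreover from this have "map2 endo_apply (replicate k 1) vs = vs"
    by (intro nth_equalityI) (simp_all add: one_endo.rep_eq)
  ultimately show "tensor_action (tprod (replicate k 1)) (tprod vs) = tprod vs"
    by (simp add: tensor_action_tprod)
qed (simp add: clinear_iff)

lemma algebra_homD:
  assumes "algebra_hom f"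
  shows "clinear f" "f (x * y) = f x * f y" "f 1 = 1"
  using assms by (auto simp: algebra_hom_def)

text \<open>For \<open>k > 0\<close> this is \<open>\<pi>\<^sub>k u\<close> before the inclusion
  into the endomorphisms of the tensor power: \<open>k\<close> slots come from \<open>k - 1\<close>
  coproducts. At \<open>k = 0\<close> truncated subtraction repeats the value at 1, hence the
  condition \<open>k > 0\<close> in the rules for 1 and for letters.\<close>

definition rep_tensor_power ::
  "('g::complex_lie_algebra uea \<Rightarrow> 'v::complex_vector endo) \<Rightarrow> nat \<Rightarrow> 'g uea \<Rightarrow> 'v endo tensor"
  where "rep_tensor_power \<pi> k u = tensor_map \<pi> (iterated_coproduct (k - 1) u)"

lemma
  assumes \<pi>: "algebra_hom \<pi>"
  shows clinear_rep_tensor_power: "clinear (rep_tensor_power \<pi> k)"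
    and rep_tensor_power_mult:
      "rep_tensor_power \<pi> k (u * v) = rep_tensor_power \<pi> k u \<odot> rep_tensor_power \<pi> k v"
    and rep_tensor_power_1: "k > 0 \<Longrightarrow> rep_tensor_power \<pi> k 1 = tprod (replicate k 1)"
    and rep_tensor_power_uea_incl: "k > 0 \<Longrightarrow> rep_tensor_power \<pi> k (uea_incl x)
      = (\<Sum>j<k. tprod ((replicate k 1)[j := \<pi> (uea_incl x)]))"
proof -
  note lin = clinear_tensor_map[OF algebra_homD(1)[OF \<pi>]]
  show "clinear (rep_tensor_power \<pi> k)"
    unfolding rep_tensor_power_def using clinear_compose[OF lin clinear_iterated_coproduct] .
  show "rep_tensor_power \<pi> k (u * v) = rep_tensor_power \<pi> k u \<odot> rep_tensor_power \<pi> k v"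
    by (simp add: rep_tensor_power_def iterated_coproduct_mult
        tensor_map_mult[OF algebra_homD(1,2)[OF \<pi>]])
  assume "k > 0"
  then obtain l where l: "k = Suc l" by (cases k) auto
  show "rep_tensor_power \<pi> k 1 = tprod (replicate k 1)"
    by (simp add: rep_tensor_power_def iterated_coproduct_1 l tensor_map_tprod[OF algebra_homD(1)[OF \<pi>]]
        algebra_homD(3)[OF \<pi>] del: replicate_Suc)
  show "rep_tensor_power \<pi> k (uea_incl x) = (\<Sum>j<k. tprod ((replicate k 1)[j := \<pi> (uea_incl x)]))"
    by (simp add: rep_tensor_power_def iterated_coproduct_uea_incl l clinear_sum[OF lin]
        tensor_map_tprod[OF algebra_homD(1)[OF \<pi>]] map_update
        algebra_homD(3)[OF \<pi>] lessThan_Suc_atMost del: replicate_Suc)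
qed

lemma rep_power_eq_tensor_action:
  "n > 0 \<Longrightarrow> rep_power \<pi> n u = restrict (tensor_action (rep_tensor_power \<pi> n u)) (tensor_power n)"
  by (simp add: rep_power_def rep_tensor_power_def)

text \<open>Outside the tensor power every component is \<open>undefined\<close>, so equality there
  is automatic.\<close>

lemma tensor_power_End_prod_eqI:
  assumes "\<And>k x. x \<in> tensor_power k \<Longrightarrow> End_component F k x = End_component G k x"
  shows "F = G"
proof -
  have "End_component F k x = End_component G k x" for k x
    using assms tensor_power_EndD(4)[of "End_component F k" k x]
      tensor_power_EndD(4)[of "End_component G k" k x] End_component[of F] End_component[of G]
    by (cases "x \<in> tensor_power k") auto
  then show ?thesis
    by (metis End_component_inject ext)
qed

text \<open>In degree 0 the counit acts by scalars; in degree \<open>k > 0\<close> the iterated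
  coproduct, the tensor power of \<open>\<pi>\<close> and the action each respect the slotwise
  product.\<close>

lemma algebra_hom_Psi:
  assumes \<pi>: "algebra_hom \<pi>"
  shows "algebra_hom (Psi \<pi>)"
proof -
  note lin = clinear_rep_tensor_power[OF \<pi>] and c = algebra_homD[OF algebra_hom_counit]
  have 0: "rep_power \<pi> 0 u x = counit u *\<^sub>C x" if "x \<in> tensor_power 0" for u x
    using that by (simp add: rep_power_def)
  have pos: "rep_power \<pi> n u x = tensor_action (rep_tensor_power \<pi> n u) x"
    if "x \<in> tensor_power n" "n > 0" for n u x
    using that by (simp add: rep_power_eq_tensor_action)
  have act: "tensor_action (rep_tensor_power \<pi> n u) x \<in> tensor_power n" if "x \<in> tensor_power n" for n u x
    by (rule tensor_map2_in_tensor_power[OF clinear_endo_apply that])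
  note ta = clinear_tensor_action(2)
  show ?thesis
    unfolding algebra_hom_def clinear_iff
  proof (intro conjI allI)
    fix u v :: "'a uea" and a :: complex
    show "Psi \<pi> (u + v) = Psi \<pi> u + Psi \<pi> v"
    proof (rule tensor_power_End_prod_eqI)
      fix k and x :: "'b tensor" assume x: "x \<in> tensor_power k"
      show "End_component (Psi \<pi> (u + v)) k x = End_component (Psi \<pi> u + Psi \<pi> v) k x"
        by (cases "k = 0") (use x in \<open>simp_all add: Psi.rep_eq plus_tensor_power_End_prod.rep_eq 0 pos
            clinear_add[OF lin] clinear_add[OF c(1)] clinear_add[OF ta] scaleC_add_left\<close>)
    qed
    show "Psi \<pi> (a *\<^sub>C u) = a *\<^sub>C Psi \<pi> u"
    proof (rule tensor_power_End_prod_eqI)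
      fix k and x :: "'b tensor" assume x: "x \<in> tensor_power k"
      show "End_component (Psi \<pi> (a *\<^sub>C u)) k x = End_component (a *\<^sub>C Psi \<pi> u) k x"
        by (cases "k = 0") (use x in \<open>simp_all add: Psi.rep_eq scaleC_tensor_power_End_prod.rep_eq 0 pos
            clinear_scale[OF lin] clinear_scale[OF c(1)] clinear_scale[OF ta] scaleC_scaleC
            scaleC_complex_def\<close>)
    qed
    show "Psi \<pi> (u * v) = Psi \<pi> u * Psi \<pi> v"
    proof (rule tensor_power_End_prod_eqI)
      fix k and x :: "'b tensor" assume x: "x \<in> tensor_power k"
      show "End_component (Psi \<pi> (u * v)) k x = End_component (Psi \<pi> u * Psi \<pi> v) k x"
        by (cases "k = 0") (use x in \<open>simp_all add: Psi.rep_eq times_tensor_power_End_prod.rep_eq 0 pos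
            act rep_tensor_power_mult[OF \<pi>] tensor_action_mult c(2) scaleC_scaleC tensor_power_closed\<close>)
    qed
    show "Psi \<pi> 1 = 1"
    proof (rule tensor_power_End_prod_eqI)
      fix k and x :: "'b tensor" assume x: "x \<in> tensor_power k"
      show "End_component (Psi \<pi> 1) k x = End_component 1 k x"
        by (cases "k = 0") (use x in \<open>simp_all add: Psi.rep_eq one_tensor_power_End_prod.rep_eq 0 pos
            rep_tensor_power_1[OF \<pi>] tensor_action_1 c(3) scaleC_one\<close>)
    qed
  qed
qed

section \<open>Product functionals on tensor powers\<close>

text \<open>The functional \<open>f 0 \<otimes> ... \<otimes> f (k - 1)\<close>, extended by 0 to
  the other degrees. Slots are indexed by numbers so that a single one can be changed by function
  update.\<close>

definition tensor_functional ::
  "nat \<Rightarrow> (nat \<Rightarrow> 'a::complex_vector \<Rightarrow> complex) \<Rightarrow> 'a tensor \<Rightarrow> complex"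
  where "tensor_functional k f =
    tensor_lift (\<lambda>us. if length us = k then \<Prod>j<k. f j (us ! j) else 0)"

lemma multilinear_tensor_functional:
  fixes f :: "nat \<Rightarrow> 'a::complex_vector \<Rightarrow> complex"
  assumes f: "\<And>j. clinear (f j)"
  shows "multilinear (\<lambda>us. if length us = k then \<Prod>j<k. f j (us ! j) else 0)"
  unfolding multilinear_def
proof (intro allI)
  fix us ws :: "'a list"
  let ?i = "length us"
  show "clinear (\<lambda>x. if length (us @ x # ws) = k then \<Prod>j<k. f j ((us @ x # ws) ! j) else 0)"
  proof (cases "?i + Suc (length ws) = k")
    case True
    \<comment> \<open>The other factors do not see \<open>x\<close>; writing 0 in its place turns
      them into a visible constant.\<close>
    have "(\<Prod>j<k. f j ((us @ x # ws) ! j))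
        = f ?i x * (\<Prod>j\<in>{..<k} - {?i}. f j ((us @ 0 # ws) ! j))" for x
    proof -
      have "(\<Prod>j<k. f j ((us @ x # ws) ! j))
          = f ?i x * (\<Prod>j\<in>{..<k} - {?i}. f j ((us @ x # ws) ! j))"
        by (subst prod.remove[of _ ?i]) (use True in auto)
      also have "(\<Prod>j\<in>{..<k} - {?i}. f j ((us @ x # ws) ! j))
          = (\<Prod>j\<in>{..<k} - {?i}. f j ((us @ 0 # ws) ! j))"
        by (rule prod.cong) (auto simp: nth_append nth_Cons')
      finally show ?thesis .
    qed
    then show ?thesis
      using True clinear_compose[OF clinear_mult_right f] by simp
  qed (simp add: clinear_iff)
qed

lemma clinear_tensor_functional: "(\<And>j. clinear (f j)) \<Longrightarrow> clinear (tensor_functional k f)"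
  unfolding tensor_functional_def by (rule clinear_tensor_lift[OF multilinear_tensor_functional])

lemma tensor_functional_tprod:
  "(\<And>j. clinear (f j)) \<Longrightarrow>
    tensor_functional k f (tprod us) = (if length us = k then \<Prod>j<k. f j (us ! j) else 0)"
  unfolding tensor_functional_def by (subst tensor_lift_tprod[OF multilinear_tensor_functional]) auto

lemma tensor_functional_cong:
  "(\<And>j. j < k \<Longrightarrow> f j = g j) \<Longrightarrow> tensor_functional k f = tensor_functional k g"
  unfolding tensor_functional_def by (metis (no_types, lifting) lessThan_iff prod.cong)

lemma clinear_fun_comb:
  fixes g h :: "'a::complex_vector \<Rightarrow> complex"
  assumes "clinear g" "clinear h" shows "clinear (\<lambda>a. c * g a + d * h a)"
  using assms unfolding clinear_iff by (auto simp: scaleC_complex_def algebra_simps)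

lemma tensor_functional_update_comb:
  assumes f: "\<And>j. clinear (f j)" and g: "clinear g" and h: "clinear h" and j: "j < k"
  shows "tensor_functional k (f(j := \<lambda>a. c * g a + d * h a)) t
    = c * tensor_functional k (f(j := g)) t + d * tensor_functional k (f(j := h)) t"
proof (rule tensor_linear_eqI)
  note lin = clinear_fun_comb[OF g h]
  have upd: "clinear ((f(j := e)) i)" if "clinear e" for e i
    using f that by simp
  show "clinear (tensor_functional k (f(j := \<lambda>a. c * g a + d * h a)))"
    by (rule clinear_tensor_functional[OF upd[OF lin]])
  show "clinear (\<lambda>t. c * tensor_functional k (f(j := g)) t + d * tensor_functional k (f(j := h)) t)"
    by (intro clinear_fun_comb clinear_tensor_functional upd g h)
  fix us
  have *: "(\<Prod>i<k. (f(j := e)) i (us ! i)) = e (us ! j) * (\<Prod>i\<in>{..<k} - {j}. f i (us ! i))" for e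
    by (subst prod.remove[of _ j]) (use j in \<open>auto intro!: prod.cong arg_cong2[of _ _ _ _ "(*)"]\<close>)
  show "tensor_functional k (f(j := \<lambda>a. c * g a + d * h a)) (tprod us)
    = c * tensor_functional k (f(j := g)) (tprod us) + d * tensor_functional k (f(j := h)) (tprod us)"
    by (simp only: tensor_functional_tprod[OF upd[OF lin]] tensor_functional_tprod[OF upd[OF g]]
        tensor_functional_tprod[OF upd[OF h]] *) (simp add: algebra_simps)
qed

lemma tensor_functional_update_scale:
  assumes f: "\<And>j. clinear (f j)" and j: "j < k"
  shows "tensor_functional k (f(j := \<lambda>a. c * f j a)) t = c * tensor_functional k f t"
  using tensor_functional_update_comb[OF f f[of j] f[of j] j, where c = c and d = 0 and t = t] by simp

text \<open>Multiplication by \<open>a\<close> in one slot is moved to the functional of that slot.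
  For \<open>j \<ge> k\<close> both updates are without effect.\<close>

lemma tensor_functional_mult_left:
  fixes a :: "'a::complex_algebra"
  assumes f: "\<And>j. clinear (f j)"
  shows "tensor_functional k f (tprod ((replicate k 1)[j := a]) \<odot> t)
    = tensor_functional k (f(j := \<lambda>b. f j (a * b))) t"
proof (rule tensor_linear_eqI)
  have f': "clinear ((f(j := \<lambda>b. f j (a * b))) i)" for i
    using f clinear_compose[OF f clinear_mult_left] by simp
  show "clinear (\<lambda>t. tensor_functional k f (tprod ((replicate k 1)[j := a]) \<odot> t))"
    by (rule clinear_compose[OF clinear_tensor_functional[OF f] clinear_tensor_power_mult(1)])
  show "clinear (tensor_functional k (f(j := \<lambda>b. f j (a * b))))"
    by (rule clinear_tensor_functional[OF f'])
  fix us
  show "tensor_functional k f (tprod ((replicate k 1)[j := a]) \<odot> tprod us)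
    = tensor_functional k (f(j := \<lambda>b. f j (a * b))) (tprod us)"
    unfolding tensor_functional_tprod[OF f'] tensor_power_mult_tprod
    by (auto simp: tensor_functional_tprod[OF f] clinear_0[OF clinear_tensor_functional[OF f]]
        nth_list_update intro!: prod.cong)
qed

section \<open>Matrix coefficients\<close>

lemma exists_functional_eq_1:
  fixes w :: "'v::complex_vector"
  assumes "w \<noteq> 0"
  obtains \<xi> :: "'v \<Rightarrow> complex" where "clinear \<xi>" "\<xi> w = 1"
proof -
  interpret vector_space_pair "scaleC :: complex \<Rightarrow> 'v \<Rightarrow> 'v" "scaleC :: complex \<Rightarrow> complex \<Rightarrow> complex" ..
  have "cv.independent {w}" using assms by (simp add: cv.independent_insert)
  from linear_independent_extend[OF this, of "\<lambda>_. 1"] that show ?thesis by auto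
qed

text \<open>The linear span of the functionals \<open>a \<mapsto> \<xi> (a v)\<close>, in inductive
  form so that vanishing can be carried from generators to combinations by rule induction.\<close>

inductive matrix_coeff :: "('v::complex_vector endo \<Rightarrow> complex) \<Rightarrow> bool" where
  matrix_coeff_base: "clinear \<xi> \<Longrightarrow> matrix_coeff (\<lambda>a. \<xi> (endo_apply a v))"
| matrix_coeff_comb:
    "matrix_coeff g \<Longrightarrow> matrix_coeff h \<Longrightarrow> matrix_coeff (\<lambda>a. c * g a + d * h a)"

lemma clinear_matrix_coeff: "matrix_coeff f \<Longrightarrow> clinear f"
  by (induction rule: matrix_coeff.induct)
    (auto intro: clinear_compose[OF _ clinear_endo_apply_left] clinear_fun_comb)

text \<open>Duality for finitely many vectors, from the fact that matrix coefficients detect nonzero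
  endomorphisms. For a new \<open>a\<close> outside the span of \<open>A\<close>, a functional
  \<open>g\<close> with value 1 at \<open>a\<close> is available, and \<open>b\<close> is replaced
  by its projection \<open>b - g b *\<^sub>C a\<close>, which is still outside the span of
  \<open>A\<close>.\<close>

lemma matrix_coeff_separates:
  assumes "finite A" "b \<notin> cv.span A"
  shows "\<exists>f. matrix_coeff f \<and> f b = 1 \<and> (\<forall>a\<in>A. f a = 0)"
  using assms
proof (induction A arbitrary: b rule: finite_induct)
  case empty
  then have "endo_apply b \<noteq> (\<lambda>_. 0)"
    using endo_apply_inject[of b 0] by (auto simp: zero_endo.rep_eq)
  then obtain v where "endo_apply b v \<noteq> 0" by blast
  then obtain \<xi> :: "'a \<Rightarrow> complex" where "clinear \<xi>" "\<xi> (endo_apply b v) = 1"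
    by (rule exists_functional_eq_1)
  then show ?case using matrix_coeff_base by blast
next
  case (insert a A)
  show ?case
  proof (cases "a \<in> cv.span A")
    case True
    then have "b \<notin> cv.span A" using insert.prems cv.span_redundant by blast
    then obtain f where f: "matrix_coeff f" "f b = 1" "\<forall>a\<in>A. f a = 0" using insert.IH by blast
    have "cv.span A \<subseteq> {a. f a = 0}"
      using f(3) clinear_subspace_vimage[OF clinear_matrix_coeff[OF f(1)] cv.subspace_single_0]
      by (intro cv.span_minimal) auto
    with True f show ?thesis by auto
  next
    case False
    then obtain g where g: "matrix_coeff g" "g a = 1" "\<forall>a\<in>A. g a = 0" using insert.IH by blast
    have "b - g b *\<^sub>C a \<notin> cv.span A"
      using insert.prems by (auto simp: cv.span_breakdown_eq)
    then obtain h where h: "matrix_coeff h" "h (b - g b *\<^sub>C a) = 1" "\<forall>a\<in>A. h a = 0"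
      using insert.IH by blast
    note lin = clinear_matrix_coeff[OF h(1)]
    \<comment> \<open>The correction by \<open>g\<close> kills \<open>a\<close>; the value at
      \<open>b\<close> becomes \<open>h b - h a * g b\<close>, which is \<open>h\<close> at the
      projection.\<close>
    have "matrix_coeff (\<lambda>x. 1 * h x + (- h a) * g x)"
      by (rule matrix_coeff_comb[OF h(1) g(1)])
    moreover have "h b - h a * g b = 1"
      using h(2) by (simp add: clinear_diff[OF lin] clinear_scale[OF lin] scaleC_complex_def mult.commute)
    ultimately show ?thesis
      using g h by (intro exI[of _ "\<lambda>x. 1 * h x + (- h a) * g x"]) auto
  qed
qed

lemma tensor_functional_tensor_action:
  assumes \<xi>: "\<And>j. clinear (\<xi> j)"
  shows "tensor_functional k \<xi> (tensor_action t (tprod (map v [0..<k])))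
    = tensor_functional k (\<lambda>j a. \<xi> j (endo_apply a (v j))) t"
proof (rule tensor_linear_eqI[OF clinear_compose[OF clinear_tensor_functional[OF \<xi>] clinear_tensor_action(2)]])
  have lin: "clinear (\<lambda>a. \<xi> j (endo_apply a (v j)))" for j
    by (rule clinear_compose[OF \<xi> clinear_endo_apply_left])
  show "clinear (tensor_functional k (\<lambda>j a. \<xi> j (endo_apply a (v j))))"
    by (rule clinear_tensor_functional[OF lin])
  show "tensor_functional k \<xi> (tensor_action (tprod us) (tprod (map v [0..<k])))
    = tensor_functional k (\<lambda>j a. \<xi> j (endo_apply a (v j))) (tprod us)" for us
    by (auto simp: tensor_action_tprod tensor_functional_tprod[OF lin] tensor_functional_tprod[OF \<xi>]
        clinear_0[OF clinear_tensor_functional[OF \<xi>]] intro!: prod.cong)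
qed

text \<open>For basic matrix coefficients the functional reads off the action of \<open>t\<close> on
  one pure tensor; general ones follow because the value is linear in each slot.\<close>

lemma tensor_functional_eq_0_if_action_eq_0:
  assumes t: "\<And>x. x \<in> tensor_power k \<Longrightarrow> tensor_action t x = 0"
    and f: "\<And>j. matrix_coeff (f j)"
  shows "tensor_functional k f t = 0"
proof -
  define base :: "('a endo \<Rightarrow> complex) \<Rightarrow> bool"
    where "base g \<longleftrightarrow> (\<exists>\<xi> v. clinear \<xi> \<and> g = (\<lambda>a. \<xi> (endo_apply a v)))" for g
  have base_mc: "matrix_coeff g" if "base g" for g
    using that matrix_coeff_base unfolding base_def by blast
  \<comment> \<open>All slots from \<open>m\<close> on are already of the basic form; the step from
    \<open>m\<close> to \<open>Suc m\<close> admits an arbitrary matrix coefficient in slot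
    \<open>m\<close>.\<close>
  have "tensor_functional k f t = 0"
    if "\<And>j. matrix_coeff (f j)" "\<And>j. j \<ge> m \<Longrightarrow> base (f j)" for f m
    using that
  proof (induction m arbitrary: f)
    case 0
    then have "\<forall>j. \<exists>\<xi> v. clinear \<xi> \<and> f j = (\<lambda>a. \<xi> (endo_apply a v))"
      unfolding base_def by blast
    then obtain \<xi> v where *: "\<And>j. clinear (\<xi> j)" "\<And>j. f j = (\<lambda>a. \<xi> j (endo_apply a (v j)))"
      by metis
    from *(2) have "f = (\<lambda>j a. \<xi> j (endo_apply a (v j)))" by blast
    then show ?case
      using tensor_functional_tensor_action[OF *(1), where v = v and t = t and k = k]
      by (simp add: t tprod_in_tensor_power clinear_0[OF clinear_tensor_functional[OF *(1)]])
  next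
    case (Suc m)
    have "tensor_functional k (f(m := g)) t = 0" if "matrix_coeff g" for g
      using that
    proof (induction rule: matrix_coeff.induct)
      case (matrix_coeff_base \<xi> v)
      then have "base (\<lambda>a. \<xi> (endo_apply a v))" unfolding base_def by blast
      then show ?case using Suc.prems base_mc by (intro Suc.IH) auto
    next
      case (matrix_coeff_comb g h c d)
      show ?case
      proof (cases "m < k")
        case True
        have "clinear (f j)" "clinear g" "clinear h" for j
          using clinear_matrix_coeff Suc.prems(1) matrix_coeff_comb by blast+
        from tensor_functional_update_comb[of f g h m k c d t, OF this True] matrix_coeff_comb
        show ?thesis by (simp add: fun_upd_def)
      next
        case False
        then have "tensor_functional k (f(m := \<lambda>a. c * g a + d * h a)) = tensor_functional k (f(m := g))"
          by (intro tensor_functional_cong) auto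
        with matrix_coeff_comb show ?thesis by (simp add: fun_upd_def)
      qed
    qed
    from this[OF Suc.prems(1)[of m]] show ?case by simp
  qed
  note * = this
  \<comment> \<open>Slots beyond \<open>k\<close> are filled with the zero functional, which is
    basic, so that the induction can be entered at \<open>m = k\<close>.\<close>
  let ?z = "\<lambda>a :: 'a endo. 0 :: complex"
  have z: "base ?z"
    unfolding base_def by (rule exI[of _ "\<lambda>_. 0"]) (simp add: clinear_iff)
  have "tensor_functional k f = tensor_functional k (\<lambda>j. if j < k then f j else ?z)"
    by (rule tensor_functional_cong) simp
  moreover have "tensor_functional k (\<lambda>j. if j < k then f j else ?z) t = 0"
    by (rule *[of _ k]) (use f z base_mc in auto)
  ultimately show ?thesis by simp
qed

section \<open>Evaluation on words\<close>

abbreviation word :: "'g::complex_lie_algebra list \<Rightarrow> 'g uea"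
  where "word xs \<equiv> prod_list (map uea_incl xs)"

text \<open>The pairing of \<open>f 0 \<otimes> ... \<otimes> f (k - 1)\<close> with
  \<open>\<pi>\<^sub>k u\<close>, for \<open>k > 0\<close>.\<close>

definition word_functional ::
  "('g::complex_lie_algebra uea \<Rightarrow> 'v::complex_vector endo) \<Rightarrow> nat \<Rightarrow> (nat \<Rightarrow> 'v endo \<Rightarrow> complex)
    \<Rightarrow> 'g uea \<Rightarrow> complex"
  where "word_functional \<pi> k f u = tensor_functional k f (rep_tensor_power \<pi> k u)"

definition slot_content :: "nat \<Rightarrow> (nat \<Rightarrow> 'a option) \<Rightarrow> 'a multiset"
  where "slot_content k os = (\<Sum>j<k. case os j of None \<Rightarrow> {#} | Some y \<Rightarrow> {#y#})"

lemma size_slot_content: "size (slot_content k os) = card {j. j < k \<and> os j \<noteq> None}"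
proof -
  have "size (slot_content k os) = (\<Sum>j<k. if os j \<noteq> None then 1 else 0)"
    unfolding slot_content_def by (simp, rule sum.cong) (auto split: option.split)
  also have "\<dots> = card {j. j < k \<and> os j \<noteq> None}"
    by (simp add: sum.If_cases Int_def)
  finally show ?thesis .
qed

lemma in_slot_content_iff: "x \<in># slot_content k os \<longleftrightarrow> (\<exists>j<k. os j = Some x)"
  by (induction k) (auto simp: slot_content_def less_Suc_eq split: option.splits)

lemma slot_content_remove:
  assumes "j < k" "os j = Some x"
  shows "slot_content k os = add_mset x (slot_content k (os(j := None)))"
proof -
  have "slot_content k (os(j := None)) = (\<Sum>i\<in>{..<k} - {j}. case os i of None \<Rightarrow> {#} | Some y \<Rightarrow> {#y#})"
    unfolding slot_content_def
    by (subst sum.remove[of _ j]) (use assms in \<open>auto intro!: sum.cong\<close>)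
  moreover have "slot_content k os
      = {#x#} + (\<Sum>i\<in>{..<k} - {j}. case os i of None \<Rightarrow> {#} | Some y \<Rightarrow> {#y#})"
    unfolding slot_content_def by (subst sum.remove[of _ j]) (use assms in auto)
  ultimately show ?thesis by simp
qed

locale uea_rep =
  fixes \<pi> :: "'g::complex_lie_algebra uea \<Rightarrow> 'v::complex_vector endo"
  assumes hom: "algebra_hom \<pi>"
begin

lemma clinear_word_functional:
  "(\<And>j. clinear (f j)) \<Longrightarrow> clinear (word_functional \<pi> k f)"
  unfolding word_functional_def
  by (rule clinear_compose[OF clinear_tensor_functional clinear_rep_tensor_power[OF hom]])

lemma word_functional_1:
  "(\<And>j. clinear (f j)) \<Longrightarrow> k > 0 \<Longrightarrow> word_functional \<pi> k f 1 = (\<Prod>j<k. f j 1)"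
  by (simp add: word_functional_def rep_tensor_power_1[OF hom] tensor_functional_tprod)

text \<open>The Leibniz rule for a primitive first letter, stated so that the functionals change and
  the rest of the word stays: this is the recursion for all inductions on words.\<close>

lemma word_functional_incl_mult:
  assumes "\<And>j. clinear (f j)" "k > 0"
  shows "word_functional \<pi> k f (uea_incl x * u)
    = (\<Sum>j<k. word_functional \<pi> k (f(j := \<lambda>b. f j (\<pi> (uea_incl x) * b))) u)"
  unfolding word_functional_def
  by (simp add: rep_tensor_power_mult[OF hom] rep_tensor_power_uea_incl[OF hom assms(2)]
      clinear_sum[OF clinear_tensor_power_mult(2)] clinear_sum[OF clinear_tensor_functional[OF assms(1)]]
      tensor_functional_mult_left[OF assms(1)])

text \<open>Each of the \<open>k\<close> slots contributes \<open>\<zeta>\<close> once. This is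
  where values become polynomial in \<open>k\<close>.\<close>

lemma word_functional_scalar_mult:
  assumes f: "\<And>j. clinear (f j)" and k: "k > 0" and z: "\<pi> (uea_incl z) = \<zeta> *\<^sub>C 1"
  shows "word_functional \<pi> k f (uea_incl z ^ m * u) = (of_nat k * \<zeta>) ^ m * word_functional \<pi> k f u"
proof (induction m)
  case (Suc m)
  have "(\<lambda>b. f j (\<pi> (uea_incl z) * b)) = (\<lambda>b. \<zeta> * f j b)" for j
    by (simp add: z mult_scaleC_left clinear_scale[OF f] scaleC_complex_def)
  then have "word_functional \<pi> k f (uea_incl z * u) = of_nat k * \<zeta> * word_functional \<pi> k f u" for u
    using tensor_functional_update_scale[of f, OF f]
    by (simp add: word_functional_incl_mult[OF f k]) (simp add: word_functional_def)
  with Suc show ?case by (simp add: mult.assoc)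
qed simp

lemma clinear_update_mult:
  "(\<And>j. clinear (f j)) \<Longrightarrow> clinear ((f(j := \<lambda>b. f j (a * b))) i)" for a :: "'v endo"
  using clinear_compose[of "f j" "(*) a", OF _ clinear_mult_left[of a]] by (cases "i = j") auto

text \<open>Each letter acts in a single slot, and a slot without a letter contributes \<open>f j 1\<close>.\<close>

lemma word_functional_short:
  assumes "\<And>j. clinear (f j)" "k > 0" "length xs < card {j. j < k \<and> f j 1 = 0}"
  shows "word_functional \<pi> k f (word xs) = 0"
  using assms
proof (induction xs arbitrary: f)
  case Nil
  then have "{j. j < k \<and> f j 1 = 0} \<noteq> {}" by (metis card.empty list.size(3) less_irrefl)
  then show ?case using Nil by (auto simp: word_functional_1)
next
  case (Cons x xs)
  have "word_functional \<pi> k (f(j := \<lambda>b. f j (\<pi> (uea_incl x) * b))) (word xs) = 0" for j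
  proof (rule Cons.IH)
    let ?f = "f(j := \<lambda>b. f j (\<pi> (uea_incl x) * b))"
    show "clinear (?f i)" for i by (rule clinear_update_mult[OF Cons.prems(1)])
    \<comment> \<open>Only slot \<open>j\<close> has changed, so at most one zero is lost, as is one
      letter.\<close>
    have "card {j. j < k \<and> f j 1 = 0} - card {j} \<le> card ({j. j < k \<and> f j 1 = 0} - {j})"
      by (rule diff_card_le_card_Diff) simp
    also have "\<dots> \<le> card {j. j < k \<and> ?f j 1 = 0}"
      by (rule card_mono) auto
    finally show "length xs < card {j. j < k \<and> ?f j 1 = 0}"
      using Cons.prems(3) by simp
  qed (use Cons in auto)
  then show ?case by (simp add: word_functional_incl_mult[OF Cons.prems(1,2)])
qed

text \<open>
  \<open>os j = Some y\<close> marks a slot dual to the letter \<open>y\<close> that still waits for it, and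
  \<open>os j = None\<close> a slot that is already normalised.
\<close>

definition dual_slots ::
  "'g set \<Rightarrow> (nat \<Rightarrow> 'v endo \<Rightarrow> complex) \<Rightarrow> (nat \<Rightarrow> 'g option) \<Rightarrow> bool"
  where "dual_slots Y f os \<longleftrightarrow> (\<forall>j. clinear (f j) \<and> (case os j of None \<Rightarrow> f j 1 = 1
    | Some y \<Rightarrow> f j 1 = 0 \<and> (\<forall>x\<in>Y. f j (\<pi> (uea_incl x)) = (if x = y then 1 else 0))))"

lemma dual_slots_zero_iff: "dual_slots Y f os \<Longrightarrow> f j 1 = 0 \<longleftrightarrow> os j \<noteq> None"
  unfolding dual_slots_def by (auto dest!: spec[of _ j] split: option.splits)

text \<open>The value counts the ways to send the letters, in turn, to distinct slots waiting for
  them. Letters and waiting slots being equal in number, a letter sent elsewhere leaves a zero that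
  no later letter can repair.\<close>

lemma word_functional_dual:
  assumes "k > 0" "dual_slots Y f os" "set xs \<subseteq> Y" "length xs = size (slot_content k os)"
  shows "\<exists>c :: nat. word_functional \<pi> k f (word xs) = of_nat c \<and> (c > 0 \<longleftrightarrow> mset xs = slot_content k os)"
  using assms
proof (induction xs arbitrary: f os)
  case Nil
  have "f j 1 = 1" if "j < k" for j
  proof -
    have "os j = None" using Nil.prems(4) that by (auto simp: size_slot_content)
    then show ?thesis using Nil.prems(2) by (auto simp: dual_slots_def dest!: spec[of _ j])
  qed
  then have "word_functional \<pi> k f (word []) = of_nat 1"
    using Nil.prems by (simp add: word_functional_1 dual_slots_def)
  moreover have "slot_content k os = {#}" using Nil.prems(4) by simp
  ultimately show ?case by fastforce
next
  case (Cons x xs)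
  have lin: "clinear (f j)" for j using Cons.prems(2) by (simp add: dual_slots_def)
  let ?f = "\<lambda>j. f(j := \<lambda>b. f j (\<pi> (uea_incl x) * b))"
  have "\<exists>c :: nat. word_functional \<pi> k (?f j) (word xs) = of_nat c
      \<and> (c > 0 \<longleftrightarrow> os j = Some x \<and> mset (x # xs) = slot_content k os)" if j: "j < k" for j
  proof (cases "os j = Some x")
    case True
    note rem = slot_content_remove[where os = os, OF j True]
    have "f j (\<pi> (uea_incl x)) = 1"
      using Cons.prems(2,3) True by (auto simp: dual_slots_def dest!: spec[of _ j])
    \<comment> \<open>A slot that has received its letter has value 1 at 1, which besides linearity
      is all that \<open>None\<close> demands; the other slots keep their labels.\<close>
    then have "clinear (?f j i) \<and> (case (os(j := None)) i of None \<Rightarrow> ?f j i 1 = 1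
        | Some y \<Rightarrow> ?f j i 1 = 0 \<and> (\<forall>x\<in>Y. ?f j i (\<pi> (uea_incl x)) = (if x = y then 1 else 0)))" for i
    proof (cases "i = j")
      case True
      then show ?thesis
        using clinear_compose[OF lin clinear_mult_left] \<open>f j (\<pi> (uea_incl x)) = 1\<close> by simp
    next
      case False
      then show ?thesis
        using Cons.prems(2)[unfolded dual_slots_def, rule_format, of i]
        by (auto split: option.splits if_splits)
    qed
    then have "dual_slots Y (?f j) (os(j := None))"
      unfolding dual_slots_def by blast
    from Cons.IH[OF Cons.prems(1) this] Cons.prems show ?thesis
      using True by (auto simp: rem fun_upd_def)
  next
    case False
    \<comment> \<open>The wrong letter leaves a waiting slot zero at 1. So there are still more
      zeros than letters left, and \<open>word_functional_short\<close> applies.\<close>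
    have "?f j j 1 = 0" if "os j \<noteq> None"
      using Cons.prems(2,3) that False by (auto simp: dual_slots_def dest!: spec[of _ j])
    then have "{i. i < k \<and> os i \<noteq> None} \<subseteq> {i. i < k \<and> ?f j i 1 = 0}"
      using dual_slots_zero_iff[OF Cons.prems(2)] by auto
    then have "card {i. i < k \<and> os i \<noteq> None} \<le> card {i. i < k \<and> ?f j i 1 = 0}"
      by (intro card_mono) auto
    then have "word_functional \<pi> k (?f j) (word xs) = 0"
      by (intro word_functional_short clinear_update_mult lin Cons.prems(1))
        (use Cons.prems(4) in \<open>auto simp: size_slot_content\<close>)
    with False show ?thesis by (intro exI[of _ 0]) simp
  qed
  then have "\<forall>j\<in>{..<k}. \<exists>c :: nat. word_functional \<pi> k (?f j) (word xs) = of_nat c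
      \<and> (c > 0 \<longleftrightarrow> os j = Some x \<and> mset (x # xs) = slot_content k os)" by blast
  from bchoice[OF this] obtain c :: "nat \<Rightarrow> nat" where
    c: "\<And>j. j < k \<Longrightarrow> word_functional \<pi> k (?f j) (word xs) = of_nat (c j)"
    and c_pos: "\<And>j. j < k \<Longrightarrow> c j > 0 \<longleftrightarrow> os j = Some x \<and> mset (x # xs) = slot_content k os"
    by auto
  have "word_functional \<pi> k f (word (x # xs)) = of_nat (\<Sum>j<k. c j)"
    by (simp add: word_functional_incl_mult[OF lin Cons.prems(1)] c)
  moreover have "(\<Sum>j<k. c j) > 0 \<longleftrightarrow> (\<exists>j<k. c j > 0)"
    by (auto simp: sum_eq_0_iff simp flip: neq0_conv)
  moreover have "(\<exists>j<k. c j > 0) \<longleftrightarrow> mset (x # xs) = slot_content k os"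
  proof
    assume *: "mset (x # xs) = slot_content k os"
    then have "x \<in># slot_content k os" by (metis list.set_intros(1) set_mset_mset)
    then show "\<exists>j<k. c j > 0" using * c_pos by (auto simp: in_slot_content_iff)
  qed (use c_pos in blast)
  ultimately show ?case by (intro exI[of _ "\<Sum>j<k. c j"]) (simp only: simp_thms)
qed

end

section \<open>The filtration of the enveloping algebra relative to a central element\<close>

text \<open>A degree filtration in which the displayed power of \<open>z\<close> counts as degree 0.
  The bound is strict, so that stage 0 is the zero space, where the descent ends.\<close>

definition words_below :: "'g::complex_lie_algebra \<Rightarrow> nat \<Rightarrow> 'g uea set"
  where "words_below z n = cv.span {uea_incl z ^ m * word xs | m xs. length xs < n}"

lemma word_in_words_below: "length xs < n \<Longrightarrow> uea_incl z ^ m * word xs \<in> words_below z n"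
  unfolding words_below_def by (rule cv.span_base) auto

lemma word_in_words_below': "length xs < n \<Longrightarrow> word xs \<in> words_below z n"
  using word_in_words_below[of xs n z 0] by simp

lemma subspace_words_below: "cv.subspace (words_below z n)"
  by (simp add: words_below_def)

lemma words_below_mono: "n \<le> n' \<Longrightarrow> words_below z n \<subseteq> words_below z n'"
  unfolding words_below_def by (rule cv.span_mono) (use order.strict_trans2 in blast)

lemma words_below_0: "words_below z 0 = {0}"
  by (simp add: words_below_def)

lemma words_below_UN: "\<exists>n. u \<in> words_below z n"
proof -
  have "\<exists>n. abs_uea t \<in> words_below z n" for t
  proof (induction t rule: tensor_induct)
    case subspace
    show ?case
      unfolding cv.subspace_def mem_Collect_eq
    proof (intro conjI ballI allI)
      show "\<exists>n. abs_uea 0 \<in> words_below z n"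
        using cv.subspace_0[OF subspace_words_below] by (auto simp: clinear_0[OF clinear_abs_uea])
    next
      fix s t assume "s \<in> {t. \<exists>n. abs_uea t \<in> words_below z n}" "t \<in> {t. \<exists>n. abs_uea t \<in> words_below z n}"
      then obtain n n' where n: "abs_uea s \<in> words_below z n" "abs_uea t \<in> words_below z n'" by auto
      then have "abs_uea s \<in> words_below z (max n n')" "abs_uea t \<in> words_below z (max n n')"
        using words_below_mono[of _ "max n n'"] by (meson max.cobounded1 max.cobounded2 subsetD)+
      then show "\<exists>n. abs_uea (s + t) \<in> words_below z n"
        by (auto simp: clinear_add[OF clinear_abs_uea] intro: cv.subspace_add[OF subspace_words_below])
    next
      fix c t assume "t \<in> {t. \<exists>n. abs_uea t \<in> words_below z n}"
      then show "\<exists>n. abs_uea (c *\<^sub>C t) \<in> words_below z n"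
        by (auto simp: clinear_scale[OF clinear_abs_uea] intro: cv.subspace_scale[OF subspace_words_below])
    qed
  next
    case (tprod us)
    show ?case unfolding abs_uea_tprod by (rule exI[of _ "Suc (length us)"], rule word_in_words_below') simp
  qed
  from this[of "rep_uea u"] show ?thesis by (simp only: abs_rep_uea)
qed

locale central_element =
  fixes z :: "'g::complex_lie_algebra"
  assumes central: "uea_incl z * u = u * uea_incl z"
begin

section \<open>Reordering words modulo lower degree\<close>

lemma central_power: "uea_incl z ^ m * u = u * uea_incl z ^ m"
proof (induction m)
  case (Suc m)
  have "uea_incl z ^ Suc m * u = uea_incl z * u * uea_incl z ^ m"
    by (simp add: Suc mult.assoc)
  then show ?case by (simp add: central[of u] mult.assoc)
qed simp

lemma words_below_incl_mult:
  assumes "u \<in> words_below z n" shows "uea_incl x * u \<in> words_below z (Suc n)"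
  using assms unfolding words_below_def[of z n]
proof (induction rule: cv.span_induct)
  case base
  show ?case by (rule clinear_subspace_vimage[OF clinear_mult_left subspace_words_below])
next
  case (step u)
  then obtain m xs where u: "u = uea_incl z ^ m * word xs" "length xs < n" by auto
  have "uea_incl x * u = uea_incl z ^ m * word (x # xs)"
    unfolding u by (simp add: central_power[of m "uea_incl x"] mult.assoc[symmetric])
  then show ?case using u by (simp only: word_in_words_below length_Cons Suc_less_eq)
qed

lemma words_below_power_mult:
  assumes "u \<in> words_below z n" shows "uea_incl z ^ m * u \<in> words_below z n"
  using assms unfolding words_below_def
proof (induction rule: cv.span_induct)
  case base
  show ?case by (rule clinear_subspace_vimage[OF clinear_mult_left cv.subspace_span])
next
  case (step u)
  then obtain m' xs where u: "u = uea_incl z ^ m' * word xs" "length xs < n" by auto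
  have "uea_incl z ^ m * u = uea_incl z ^ (m + m') * word xs"
    unfolding u by (simp add: power_add mult.assoc)
  then show ?case using u(2) by (intro cv.span_base) auto
qed

text \<open>Each transposition of \<open>x\<close> with a letter \<open>y\<close> costs a word in
  which both are replaced by their bracket, hence one letter shorter.\<close>

lemma word_move_in_words_below:
  "word (x # a @ b) - word (a @ x # b) \<in> words_below z (Suc (length a + length b))"
proof (induction a)
  case Nil
  show ?case using cv.subspace_0[OF subspace_words_below] by simp
next
  case (Cons y a)
  have "word (lie_bracket x y # a @ b) \<in> words_below z (Suc (length (y # a) + length b))"
    by (rule word_in_words_below') simp
  moreover have "uea_incl y * (word (x # a @ b) - word (a @ x # b))
      \<in> words_below z (Suc (length (y # a) + length b))"
    using words_below_incl_mult[OF Cons] by simp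
  moreover have "word (x # (y # a) @ b) - word ((y # a) @ x # b)
      = word (lie_bracket x y # a @ b) + uea_incl y * (word (x # a @ b) - word (a @ x # b))"
    by (simp add: uea_incl_bracket algebra_simps)
  ultimately show ?case
    using cv.subspace_add[OF subspace_words_below] by metis
qed

text \<open>Commutativity of the associated graded algebra: the first letter of \<open>xs\<close> is
  fetched to the front of \<open>ys\<close>, then the tails are compared.\<close>

lemma word_permute_in_words_below:
  "mset xs = mset ys \<Longrightarrow> word xs - word ys \<in> words_below z (length xs)"
proof (induction xs arbitrary: ys)
  case Nil
  then show ?case using cv.subspace_0[OF subspace_words_below] by simp
next
  case (Cons x xs)
  then have "x \<in> set ys" by (metis list.set_intros(1) set_mset_mset)
  then obtain a b where ys: "ys = a @ x # b" by (auto simp: in_set_conv_decomp)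
  with Cons.prems have xs: "mset xs = mset (a @ b)" by simp
  then have len: "length xs = length a + length b" by (metis length_append size_mset)
  have "uea_incl x * (word xs - word (a @ b)) \<in> words_below z (length (x # xs))"
    using words_below_incl_mult[OF Cons.IH[OF xs]] by simp
  moreover have "word (x # a @ b) - word (a @ x # b) \<in> words_below z (length (x # xs))"
    using word_move_in_words_below[of x a b] len by simp
  moreover have "word (x # xs) - word ys
      = uea_incl x * (word xs - word (a @ b)) + (word (x # a @ b) - word (a @ x # b))"
    by (simp add: ys algebra_simps)
  ultimately show ?case
    using cv.subspace_add[OF subspace_words_below] by metis
qed

text \<open>Any enumeration serves, since by \<open>word_permute_in_words_below\<close> two of them
  differ by an element of lower degree.\<close>

definition multiset_word :: "'g multiset \<Rightarrow> 'g uea"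
  where "multiset_word \<alpha> = word (SOME xs. mset xs = \<alpha>)"

lemma multiset_word_word: "\<exists>xs. mset xs = \<alpha> \<and> multiset_word \<alpha> = word xs"
  unfolding multiset_word_def using someI_ex[OF ex_mset[of \<alpha>]] by blast

definition leading_terms :: "'g set \<Rightarrow> nat \<Rightarrow> 'g uea set"
  where "leading_terms B n =
    {uea_incl z ^ m * multiset_word \<alpha> | m \<alpha>. size \<alpha> = n \<and> set_mset \<alpha> \<subseteq> B}"

text \<open>The spanning half of the Poincare-Birkhoff-Witt theorem.\<close>

lemma words_below_Suc:
  assumes B: "cv.span (insert z B) = UNIV" and u: "u \<in> words_below z (Suc n)"
  shows "\<exists>v \<in> cv.span (leading_terms B n). \<exists>w \<in> words_below z n. u = v + w"
proof -
  define W where "W = cv.span (leading_terms B n \<union> words_below z n)"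
  have W: "cv.subspace W" "leading_terms B n \<subseteq> W" "words_below z n \<subseteq> W"
    by (auto simp: W_def intro: cv.span_base)
  \<comment> \<open>Letters are expanded from left to right; \<open>ps\<close> is the prefix whose
    letters already lie in \<open>B\<close>.\<close>
  have "uea_incl z ^ m * word (ps @ xs) \<in> W"
    if "length ps + length xs = n" "set ps \<subseteq> B" for m ps xs
    using that
  proof (induction xs arbitrary: ps m)
    case Nil
    obtain ys where ys: "mset ys = mset ps" "multiset_word (mset ps) = word ys"
      using multiset_word_word by blast
    have "uea_incl z ^ m * (word ps - word ys) \<in> words_below z n"
      using words_below_power_mult[OF word_permute_in_words_below[OF ys(1)[symmetric]]] Nil by simp
    moreover have "uea_incl z ^ m * word ys \<in> leading_terms B n"
      unfolding leading_terms_def ys(2)[symmetric]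
      by (intro CollectI exI conjI, rule refl) (use Nil in auto)
    ultimately have "uea_incl z ^ m * (word ps - word ys) + uea_incl z ^ m * word ys \<in> W"
      using W by (intro cv.subspace_add[OF W(1)]) auto
    then show ?case by (simp add: algebra_simps)
  next
    case (Cons x xs)
    have "clinear (\<lambda>x. uea_incl z ^ m * (word ps * (uea_incl x * word xs)))"
      by (intro clinear_compose[OF clinear_mult_left] clinear_compose[OF clinear_mult_right]
          clinear_uea_incl)
    note sub = clinear_subspace_vimage[OF this W(1)]
    have z: "uea_incl z ^ m * (word ps * (uea_incl z * word xs)) = uea_incl z ^ Suc m * word (ps @ xs)"
    proof -
      have "word ps * (uea_incl z * word xs) = uea_incl z * word (ps @ xs)"
        by (simp add: mult.assoc[symmetric] central[of "word ps"])
      then show ?thesis by (simp only: power_Suc2 mult.assoc)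
    qed
    \<comment> \<open>By linearity in the letter it remains to treat \<open>z\<close> and the
      elements of \<open>B\<close>. The letter \<open>z\<close> joins the central power, and the
      shortened word has lower degree; a letter from \<open>B\<close> joins the prefix.\<close>
    have "cv.span (insert z B) \<subseteq> {x. uea_incl z ^ m * (word ps * (uea_incl x * word xs)) \<in> W}"
    proof (rule cv.span_minimal[OF _ sub], rule subsetI)
      fix y assume "y \<in> insert z B"
      then consider "y = z" | "y \<in> B" by blast
      then show "y \<in> {x. uea_incl z ^ m * (word ps * (uea_incl x * word xs)) \<in> W}"
      proof cases
        case 1
        have "uea_incl z ^ Suc m * word (ps @ xs) \<in> words_below z n"
          by (rule word_in_words_below) (use Cons.prems in simp)
        with W show ?thesis unfolding 1 mem_Collect_eq z by blast
      next
        case 2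
        with Cons.IH[of "ps @ [y]" m] Cons.prems show ?thesis by (simp add: mult.assoc)
      qed
    qed
    then show ?case using B by (auto simp: mult.assoc)
  qed
  then have word: "uea_incl z ^ m * word xs \<in> W" if "length xs = n" for m xs
    using that by (metis append_Nil empty_subsetI list.set(1) list.size(3) add_0)
  have "{uea_incl z ^ m * word xs | m xs. length xs < Suc n} \<subseteq> W"
  proof safe
    fix m and xs :: "'g list" assume "length xs < Suc n"
    then show "uea_incl z ^ m * word xs \<in> W"
      using word word_in_words_below[of xs n z m] W(3) by (cases "length xs = n") auto
  qed
  then have "words_below z (Suc n) \<subseteq> W"
    unfolding words_below_def[of z "Suc n"] by (rule cv.span_minimal[OF _ W(1)])
  with u have "u \<in> W" by blast
  then show ?thesis
    unfolding W_def cv.span_Un by (auto simp: words_below_def cv.span_span)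
qed

end

section \<open>Injectivity\<close>

text \<open>If \<open>\<zeta> = 1\<close>, a polynomial vanishes at infinitely many integers, so its
  coefficients are 0 and \<open>Z\<close> may be substituted for the variable. Several
  \<open>a\<close> may share an exponent, hence the regrouping by \<open>m a\<close>.\<close>

lemma sum_scaled_powers_eq_0:
  fixes Z :: "'a::complex_algebra" and r :: "'i \<Rightarrow> complex"
  assumes t: "finite t" and Z: "\<zeta> = 1 \<or> \<zeta> = 0 \<and> Z = 0"
    and zero: "\<And>k. k \<ge> k0 \<Longrightarrow> (\<Sum>a\<in>t. r a * (of_nat k * \<zeta>) ^ m a) = 0"
  shows "(\<Sum>a\<in>t. r a *\<^sub>C Z ^ m a) = 0"
  using Z
proof
  assume "\<zeta> = 1"
  define p where "p = (\<Sum>a\<in>t. monom (r a) (m a))"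
  have "poly p (of_nat k) = 0" if "k \<ge> k0" for k
    using zero[OF that] \<open>\<zeta> = 1\<close> by (simp add: p_def poly_sum poly_monom)
  then have "of_nat ` {k0..} \<subseteq> {x. poly p x = 0}" by auto
  moreover have "infinite (of_nat ` {k0..} :: complex set)"
    by (simp add: finite_image_iff infinite_Ici)
  ultimately have "p = 0" using poly_roots_finite finite_subset by blast
  have coeff: "(\<Sum>a\<in>{a\<in>t. m a = i}. r a) = 0" for i
  proof -
    have "(\<Sum>a\<in>{a\<in>t. m a = i}. r a) = (\<Sum>a\<in>t. if m a = i then r a else 0)"
      by (rule sum.inter_filter[OF t])
    also have "\<dots> = coeff p i" by (simp add: p_def coeff_sum)
    finally show ?thesis using \<open>p = 0\<close> by simp
  qed
  have "(\<Sum>a\<in>t. r a *\<^sub>C Z ^ m a) = (\<Sum>i\<in>m ` t. \<Sum>a\<in>{a\<in>t. m a = i}. r a *\<^sub>C Z ^ m a)"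
    by (rule sum.image_gen[OF t])
  also have "\<dots> = (\<Sum>i\<in>m ` t. (\<Sum>a\<in>{a\<in>t. m a = i}. r a) *\<^sub>C Z ^ i)"
    by (simp add: cv.scale_sum_left)
  finally show ?thesis by (simp add: coeff)
next
  assume *: "\<zeta> = 0 \<and> Z = 0"
  \<comment> \<open>Both powers of 0 are 1 for exponent 0 and vanish otherwise, so the hypothesis at
    \<open>k0\<close> alone gives the sum.\<close>
  then have "r a *\<^sub>C Z ^ m a = (r a * (of_nat k0 * \<zeta>) ^ m a) *\<^sub>C 1" for a
    by (cases "m a") simp_all
  then have "(\<Sum>a\<in>t. r a *\<^sub>C Z ^ m a) = (\<Sum>a\<in>t. r a * (of_nat k0 * \<zeta>) ^ m a) *\<^sub>C 1"
    by (simp add: cv.scale_sum_left)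
  then show ?thesis by (simp add: zero)
qed

locale faithful_rep = uea_rep \<pi>
  for \<pi> :: "'g::complex_lie_algebra uea \<Rightarrow> 'v::complex_vector endo" +
  assumes faithful: "inj (\<lambda>x. \<pi> (uea_incl x))"
begin

abbreviation act :: "'g \<Rightarrow> 'v endo"
  where "act x \<equiv> \<pi> (uea_incl x)"

section \<open>Scalars in the image of the Lie algebra\<close>

lemma clinear_act: "clinear act"
  by (rule clinear_compose[OF algebra_homD(1)[OF hom] clinear_uea_incl])

lemma act_image_span: "cv.span (act ` S) = act ` cv.span S"
  by (rule module_hom.span_image) (rule clinear_act[THEN Vector_Spaces.linear.axioms(3)])

text \<open>A scalar commutes with everything, so \<open>act\<close> kills each bracket with
  \<open>z\<close>; by faithfulness these brackets are 0, and \<open>z\<close> commutes with all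
  words.\<close>

lemma scalar_imp_central:
  assumes "act z = \<zeta> *\<^sub>C 1"
  shows "uea_incl z * u = u * uea_incl z"
proof -
  have "uea_incl z * uea_incl x = uea_incl x * uea_incl z" for x
  proof -
    have "act (lie_bracket z x) = act z * act x - act x * act z"
      by (simp add: uea_incl_bracket clinear_diff[OF algebra_homD(1)[OF hom]] algebra_homD(2)[OF hom])
    also have "\<dots> = act 0"
      by (simp add: assms mult_scaleC_left mult_scaleC_right clinear_0[OF clinear_act])
    finally have "lie_bracket z x = 0" using faithful by (simp add: inj_def)
    then show ?thesis
      using uea_incl_bracket[of z x] by (simp add: clinear_0[OF clinear_uea_incl])
  qed
  note comm = this
  have "uea_incl z * word xs = word xs * uea_incl z" for xs
  proof (induction xs)
    case (Cons x xs)
    have "uea_incl z * word (x # xs) = uea_incl x * (uea_incl z * word xs)"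
      by (simp add: mult.assoc[symmetric] comm)
    then show ?case by (simp add: Cons mult.assoc)
  qed simp
  then show ?thesis
    by (rule uea_linear_eqI[OF clinear_mult_left clinear_mult_right])
qed

text \<open>Either \<open>z\<close> maps to 1, is nonzero because \<open>1 \<noteq> 0\<close>, and
  extends to a basis, or \<open>z = 0\<close> and \<open>B\<close> is any basis. In both cases the
  images of \<open>B\<close> are independent modulo scalars, which provides dual functionals
  vanishing at 1.\<close>

lemma scalar_complement:
  assumes "(1 :: 'v endo) \<noteq> 0"
  obtains z \<zeta> B where "act z = \<zeta> *\<^sub>C 1" "\<zeta> = 1 \<or> \<zeta> = 0 \<and> uea_incl z = 0"
    "cv.span (insert z B) = UNIV"
    "\<And>y. y \<in> B \<Longrightarrow> act y \<notin> cv.span (insert 1 (act ` (B - {y})))"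
proof (cases "\<exists>z. act z = 1")
  case True
  then obtain z where z: "act z = 1" by blast
  have "z \<noteq> 0" using z assms clinear_0[OF clinear_act] by auto
  then have ind: "cv.independent {z}" by (simp add: cv.independent_insert)
  define E where "E = cv.extend_basis {z}"
  have E: "z \<in> E" "cv.independent E" "cv.span E = UNIV"
    using cv.extend_basis_superset[OF ind] cv.independent_extend_basis[OF ind]
      cv.span_extend_basis[OF ind] by (auto simp: E_def)
  have "act y \<notin> cv.span (insert 1 (act ` (E - {z} - {y})))" if "y \<in> E - {z}" for y
  proof
    assume *: "act y \<in> cv.span (insert 1 (act ` (E - {z} - {y})))"
    have "insert 1 (act ` (E - {z} - {y})) = act ` (E - {y})"
      using E(1) that z by (auto simp: image_iff)
    with * have "y \<in> cv.span (E - {y})"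
      using inj_image_mem_iff[OF faithful, of y] by (simp only: act_image_span)
    with E(2) that show False by (auto simp: cv.dependent_def)
  qed
  then show ?thesis
    using E z by (intro that[of z 1 "E - {z}"]) (simp_all add: scaleC_one insert_absorb)
next
  case False
  have ind: "cv.independent ({} :: 'g set)" by (rule cv.independent_empty)
  define E where "E = cv.extend_basis ({} :: 'g set)"
  have E: "cv.independent E" "cv.span E = UNIV"
    using cv.independent_extend_basis[OF ind] cv.span_extend_basis[OF ind] by (auto simp: E_def)
  have "act y \<notin> cv.span (insert 1 (act ` (E - {y})))" if "y \<in> E" for y
  proof
    assume "act y \<in> cv.span (insert 1 (act ` (E - {y})))"
    then obtain c s where s: "s \<in> cv.span (E - {y})" "act y - c *\<^sub>C 1 = act s"
      unfolding cv.span_breakdown_eq act_image_span by auto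
    then have "act (y - s) = c *\<^sub>C 1" by (simp add: clinear_diff[OF clinear_act] algebra_simps)
    \<comment> \<open>A nonzero \<open>c\<close> would yield a preimage of 1, excluded in this
      case.\<close>
    then have "act ((1 / c) *\<^sub>C (y - s)) = 1" if "c \<noteq> 0"
      using that by (simp only: clinear_scale[OF clinear_act]) (simp add: scaleC_scaleC scaleC_one)
    with False have "c = 0" by blast
    with s have "y = s" using faithful by (simp add: inj_def)
    with s E(1) \<open>y \<in> E\<close> show False by (auto simp: cv.dependent_def)
  qed
  then show ?thesis
    using E by (intro that[of 0 0 E])
      (simp_all add: clinear_0[OF clinear_act] clinear_0[OF clinear_uea_incl] cv.span_insert_0
        clinear_0[OF algebra_homD(1)[OF hom]])
qed

text \<open>Powers of \<open>z\<close> only rescale, and the words have fewer letters than there are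
  zeros at 1.\<close>

lemma words_below_killed:
  assumes z: "act z = \<zeta> *\<^sub>C 1"
    and f: "\<And>j. clinear (f j)" and k: "k > 0" and n: "n \<le> card {j. j < k \<and> f j 1 = 0}"
    and u: "u \<in> words_below z n"
  shows "word_functional \<pi> k f u = 0"
  using u unfolding words_below_def
proof (induction rule: cv.span_induct)
  case base
  show ?case
    using clinear_subspace_vimage[OF clinear_word_functional[OF f] cv.subspace_single_0] by simp
next
  case (step u)
  then obtain m xs where "u = uea_incl z ^ m * word xs" "length xs < n" by auto
  then show ?case
    using n by (simp add: word_functional_scalar_mult[OF f k z] word_functional_short[OF f k])
qed

text \<open>One step of the descent: for every multiset the coefficient, a polynomial in
  \<open>z\<close>, is shown to vanish in the enveloping algebra, so only the lower part
  \<open>w\<close> is left.\<close>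

lemma words_below_kernel_step:
  assumes nontrivial: "(1 :: 'v endo) \<noteq> 0"
    and z: "act z = \<zeta> *\<^sub>C 1" "\<zeta> = 1 \<or> \<zeta> = 0 \<and> uea_incl z = 0"
    and B: "cv.span (insert z B) = UNIV"
      "\<And>y. y \<in> B \<Longrightarrow> act y \<notin> cv.span (insert 1 (act ` (B - {y})))"
    and kernel: "\<And>k f. k > 0 \<Longrightarrow> (\<And>j. matrix_coeff (f j)) \<Longrightarrow> word_functional \<pi> k f u = 0"
    and u: "u \<in> words_below z (Suc n)"
  shows "u \<in> words_below z n"
proof -
  interpret central_element z
    by unfold_locales (rule scalar_imp_central[OF z(1)])
  obtain v w where v: "v \<in> cv.span (leading_terms B n)" and w: "w \<in> words_below z n" and "u = v + w"
    using words_below_Suc[OF B(1) u] by blast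
  obtain t r where t: "finite t" "t \<subseteq> leading_terms B n" and v_eq: "v = (\<Sum>a\<in>t. r a *\<^sub>C a)"
    using v unfolding cv.span_explicit by blast
  have "\<forall>a\<in>t. \<exists>m \<alpha>. a = uea_incl z ^ m * multiset_word \<alpha> \<and> size \<alpha> = n \<and> set_mset \<alpha> \<subseteq> B"
    using t(2) unfolding leading_terms_def by blast
  then obtain m \<alpha> where a: "\<And>a. a \<in> t \<Longrightarrow> a = uea_incl z ^ m a * multiset_word (\<alpha> a)"
    and \<alpha>: "\<And>a. a \<in> t \<Longrightarrow> size (\<alpha> a) = n" "\<And>a. a \<in> t \<Longrightarrow> set_mset (\<alpha> a) \<subseteq> B"
    by metis
  \<comment> \<open>Only the finitely many letters that occur need dual functionals, so separation
    from a finite set suffices.\<close>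
  define Y where "Y = (\<Union>a\<in>t. set_mset (\<alpha> a))"
  have Y: "finite Y" "Y \<subseteq> B" using t(1) \<alpha>(2) by (auto simp: Y_def)
  have "\<exists>f. matrix_coeff f \<and> f 1 = 0 \<and> (\<forall>x\<in>Y. f (act x) = (if x = y then 1 else 0))"
    if "y \<in> Y" for y
  proof -
    have "act y \<notin> cv.span (insert 1 (act ` (Y - {y})))"
      using B(2)[of y] that Y(2) cv.span_mono[of "insert 1 (act ` (Y - {y}))" "insert 1 (act ` (B - {y}))"]
      by blast
    from matrix_coeff_separates[OF _ this] Y(1) obtain f where
      "matrix_coeff f" "f (act y) = 1" "\<forall>a\<in>insert 1 (act ` (Y - {y})). f a = 0" by auto
    then show ?thesis by (intro exI[of _ f]) auto
  qed
  then obtain dual where dual: "\<And>y. y \<in> Y \<Longrightarrow> matrix_coeff (dual y) \<and> dual y 1 = 0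
      \<and> (\<forall>x\<in>Y. dual y (act x) = (if x = y then 1 else 0))"
    by metis
  obtain unit :: "'v endo \<Rightarrow> complex" where unit: "matrix_coeff unit" "unit 1 = 1"
    using matrix_coeff_separates[of "{}" "1 :: 'v endo"] nontrivial by auto
  have "(\<Sum>a\<in>{a\<in>t. \<alpha> a = \<beta>}. r a *\<^sub>C uea_incl z ^ m a) = 0" if \<beta>: "\<beta> \<in> \<alpha> ` t" for \<beta>
  proof (rule sum_scaled_powers_eq_0[OF _ z(2)])
    show "finite {a \<in> t. \<alpha> a = \<beta>}" using t(1) by simp
    \<comment> \<open>The threshold leaves room for \<open>n\<close> dual slots and makes
      \<open>k\<close> positive also when \<open>n = 0\<close>.\<close>
    fix k :: nat assume k: "k \<ge> Suc n"
    then have "k > 0" by simp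
    obtain ys where ys: "mset ys = \<beta>" using ex_mset by blast
    have "set ys = set_mset \<beta>" using ys by auto
    then have ys_Y: "set ys \<subseteq> Y" using \<beta> by (auto simp: Y_def)
    have "length ys = size \<beta>" using ys by auto
    then have len: "length ys = n" using \<beta> \<alpha>(1) by auto
    \<comment> \<open>One dual slot for each entry of \<open>ys\<close>, so that a repeated letter
      gets several; all further slots take the value 1 at 1.\<close>
    define f where "f j = (if j < n then dual (ys ! j) else unit)" for j
    define os where "os j = (if j < n then Some (ys ! j) else None)" for j
    have f_mc: "matrix_coeff (f j)" for j
      using dual unit ys_Y len by (auto simp: f_def subset_iff)
    then have lin: "clinear (f j)" for j by (rule clinear_matrix_coeff)
    have "clinear (f j) \<and> (case os j of None \<Rightarrow> f j 1 = 1
        | Some y \<Rightarrow> f j 1 = 0 \<and> (\<forall>x\<in>Y. f j (act x) = (if x = y then 1 else 0)))" for j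
    proof (cases "j < n")
      case True
      then have "ys ! j \<in> Y" using ys_Y len by auto
      from dual[OF this] lin[of j] True show ?thesis by (simp add: f_def os_def)
    next
      case False
      with lin[of j] unit show ?thesis by (simp add: f_def os_def)
    qed
    then have slots: "dual_slots Y f os" unfolding dual_slots_def by blast
    have "slot_content k os = (\<Sum>j<n. {#ys ! j#})"
      unfolding slot_content_def
      by (rule sum.mono_neutral_cong_right) (use k in \<open>auto simp: os_def\<close>)
    also have "\<dots> = mset (map (\<lambda>j. ys ! j) [0..<n])"
      by (simp add: sum_unfold_sum_mset lessThan_atLeast0)
    also have "\<dots> = \<beta>" unfolding len[symmetric] map_nth by (rule ys)
    finally have cont: "slot_content k os = \<beta>" .
    have val: "\<exists>c :: nat. word_functional \<pi> k f (multiset_word \<gamma>) = of_nat c \<and> (c > 0 \<longleftrightarrow> \<gamma> = \<beta>)"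
      if "\<gamma> \<in> \<alpha> ` t" for \<gamma>
    proof -
      obtain xs where xs: "mset xs = \<gamma>" "multiset_word \<gamma> = word xs"
        using multiset_word_word by blast
      have "set xs = set_mset \<gamma>" "length xs = size \<gamma>" using xs(1) by auto
      then have "set xs \<subseteq> Y" "length xs = size (slot_content k os)"
        using that \<beta> \<alpha>(1) by (auto simp: Y_def cont)
      from word_functional_dual[OF \<open>k > 0\<close> slots this] xs show ?thesis by (simp add: cont)
    qed
    obtain c :: nat where c: "word_functional \<pi> k f (multiset_word \<beta>) = of_nat c" "c > 0"
      using val[OF \<beta>] by blast
    have other: "word_functional \<pi> k f (multiset_word (\<alpha> a)) = 0" if "a \<in> t" "\<alpha> a \<noteq> \<beta>" for a
      using val[of "\<alpha> a"] that by auto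
    note lin_wf = clinear_word_functional[of f, OF lin]
    have "n \<le> card {j. j < k \<and> f j 1 = 0}"
    proof -
      have "f j 1 = 0" if "j < n" for j
        using that dual ys_Y len by (auto simp: f_def subset_iff)
      then have "{..<n} \<subseteq> {j. j < k \<and> f j 1 = 0}" using k by auto
      then have "card {..<n} \<le> card {j. j < k \<and> f j 1 = 0}" by (intro card_mono) auto
      then show ?thesis by simp
    qed
    from words_below_killed[of z \<zeta> f, OF z(1) lin \<open>k > 0\<close> this w]
    have "word_functional \<pi> k f v = 0"
      using kernel[OF \<open>k > 0\<close>, of f, OF f_mc] \<open>u = v + w\<close> by (simp add: clinear_add[OF lin_wf])
    moreover have "word_functional \<pi> k f v
        = (\<Sum>a\<in>t. r a * word_functional \<pi> k f (uea_incl z ^ m a * multiset_word (\<alpha> a)))"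
      unfolding v_eq using a
      by (simp add: clinear_sum[OF lin_wf] clinear_scale[OF lin_wf] scaleC_complex_def cong: sum.cong)
    moreover have "\<dots> = (\<Sum>a\<in>t. r a * (of_nat k * \<zeta>) ^ m a * word_functional \<pi> k f (multiset_word (\<alpha> a)))"
      by (simp add: word_functional_scalar_mult[of f, OF lin \<open>k > 0\<close> z(1)] mult.assoc)
    moreover have "\<dots> = (\<Sum>a\<in>{a\<in>t. \<alpha> a = \<beta>}. r a * (of_nat k * \<zeta>) ^ m a * of_nat c)"
      by (rule sum.mono_neutral_cong_right) (use t(1) other c in auto)
    ultimately have "(\<Sum>a\<in>{a\<in>t. \<alpha> a = \<beta>}. r a * (of_nat k * \<zeta>) ^ m a) * of_nat c = 0"
      by (simp only: sum_distrib_right)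
    with c(2) show "(\<Sum>a\<in>{a\<in>t. \<alpha> a = \<beta>}. r a * (of_nat k * \<zeta>) ^ m a) = 0" by simp
  qed
  note zero = this
  have "v = (\<Sum>a\<in>t. (r a *\<^sub>C uea_incl z ^ m a) * multiset_word (\<alpha> a))"
    unfolding v_eq by (rule sum.cong) (use a in \<open>auto simp: mult_scaleC_left\<close>)
  \<comment> \<open>Collecting the terms with equal multiset exhibits the coefficients just shown to
    vanish.\<close>
  also have "\<dots> = (\<Sum>\<beta>\<in>\<alpha> ` t. \<Sum>a\<in>{a\<in>t. \<alpha> a = \<beta>}. (r a *\<^sub>C uea_incl z ^ m a) * multiset_word (\<alpha> a))"
    by (rule sum.image_gen[OF t(1)])
  also have "\<dots> = (\<Sum>\<beta>\<in>\<alpha> ` t. (\<Sum>a\<in>{a\<in>t. \<alpha> a = \<beta>}. r a *\<^sub>C uea_incl z ^ m a) * multiset_word \<beta>)"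
    by (simp add: clinear_sum[OF clinear_mult_right])
  also have "\<dots> = 0" by (simp add: zero)
  finally show ?thesis using \<open>u = v + w\<close> w by simp
qed

lemma uea_eq_0I:
  assumes nontrivial: "(1 :: 'v endo) \<noteq> 0"
    and kernel: "\<And>k f. k > 0 \<Longrightarrow> (\<And>j. matrix_coeff (f j)) \<Longrightarrow> word_functional \<pi> k f u = 0"
  shows "u = 0"
proof -
  obtain z \<zeta> B where zB: "act z = \<zeta> *\<^sub>C 1" "\<zeta> = 1 \<or> \<zeta> = 0 \<and> uea_incl z = 0"
    "cv.span (insert z B) = UNIV"
    "\<And>y. y \<in> B \<Longrightarrow> act y \<notin> cv.span (insert 1 (act ` (B - {y})))"
    using scalar_complement[OF nontrivial] by blast
  obtain n where "u \<in> words_below z n" using words_below_UN by blast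
  then have "u \<in> words_below z 0"
  proof (induction n)
    case (Suc n)
    from words_below_kernel_step[OF nontrivial zB kernel Suc.prems] Suc.IH show ?case by blast
  qed
  then show ?thesis by (simp add: words_below_0)
qed

text \<open>For nonzero \<open>V\<close> the components of positive degree supply the hypothesis of
  \<open>uea_eq_0I\<close>; the case \<open>V = 0\<close> is settled in degree 0.\<close>

lemma Psi_eq_0_imp:
  assumes "Psi \<pi> u = 0"
  shows "u = 0"
proof -
  have comp: "rep_power \<pi> k u x = 0" if "x \<in> tensor_power k" for k x
    using arg_cong[OF assms, of "\<lambda>F. End_component F k x"] that
    by (simp add: Psi.rep_eq zero_tensor_power_End_prod.rep_eq)
  show ?thesis
  proof (cases "(1 :: 'v endo) = 0")
    case False
    then show ?thesis
    proof (rule uea_eq_0I)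
      fix k :: nat and f :: "nat \<Rightarrow> 'v endo \<Rightarrow> complex"
      assume k: "k > 0" and f: "\<And>j. matrix_coeff (f j)"
      have "tensor_action (rep_tensor_power \<pi> k u) x = 0" if "x \<in> tensor_power k" for x
        using comp[OF that] that by (simp add: rep_power_eq_tensor_action[OF k])
      then show "word_functional \<pi> k f u = 0"
        unfolding word_functional_def by (rule tensor_functional_eq_0_if_action_eq_0[OF _ f])
    qed
  next
    \<comment> \<open>Here \<open>V = 0\<close>, so by faithfulness the Lie algebra is 0, its
      enveloping algebra is spanned by 1, and the counit determines \<open>u\<close>.\<close>
    case True
    have "a = 0" for a :: "'v endo" using True mult_1_right[of a] by (metis mult_zero_right)
    then have "x = 0" for x :: 'g using faithful by (metis injD)
    then have g: "uea_incl x = 0" for x :: 'g by (metis clinear_0 clinear_uea_incl)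
    have c: "clinear (counit :: 'g uea \<Rightarrow> complex)" "counit (1 :: 'g uea) = 1"
      using algebra_homD[OF algebra_hom_counit] by blast+
    have "u = counit u *\<^sub>C 1"
    proof (rule uea_linear_eqI[of "\<lambda>u. u" "\<lambda>u. counit u *\<^sub>C 1"])
      show "word xs = counit (word xs) *\<^sub>C 1" for xs :: "'g list"
        by (cases xs) (simp_all add: g c(2) clinear_0[OF c(1)] scaleC_one)
      have "clinear (\<lambda>a :: complex. a *\<^sub>C (1 :: 'g uea))"
        by (simp add: clinear_iff scaleC_add_left scaleC_scaleC scaleC_complex_def)
      from clinear_compose[OF this c(1)] show "clinear (\<lambda>u :: 'g uea. counit u *\<^sub>C (1 :: 'g uea))" .
    qed (simp_all add: clinear_iff)
    moreover have "counit u = 0"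
    proof -
      have one: "(tprod [] :: 'v tensor) \<in> tensor_power 0" by (rule tprod_in_tensor_power) simp
      with comp[of "tprod []" 0] have "counit u *\<^sub>C (tprod [] :: 'v tensor) = 0"
        by (simp add: rep_power_def)
      moreover have lin: "clinear (\<lambda>x :: 'v. 0 :: complex)" by (simp add: clinear_iff)
      \<comment> \<open>With no slots the product functional is the empty product, so its value at
        \<open>tprod []\<close> is 1.\<close>
      then have "(tprod [] :: 'v tensor) \<noteq> 0"
        using tensor_functional_tprod[of "\<lambda>j x. 0" 0 "[] :: 'v list"]
          clinear_0[OF clinear_tensor_functional[of "\<lambda>j x :: 'v. 0 :: complex" 0]] by auto
      ultimately show ?thesis by simp
    qed
    ultimately show ?thesis by simp
  qed
qed

end

theorem theoremA1:
  fixes \<pi> :: "'g::complex_lie_algebra uea \<Rightarrow> 'v::complex_vector endo"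
  assumes "algebra_hom \<pi>"
    and "inj (\<lambda>x. \<pi> (uea_incl x))"
  shows "algebra_hom (Psi \<pi>) \<and> inj (Psi \<pi>)"
proof
  interpret faithful_rep \<pi>
    by unfold_locales (rule assms)+
  show *: "algebra_hom (Psi \<pi>)" by (rule algebra_hom_Psi[OF assms(1)])
  show "inj (Psi \<pi>)"
  proof (rule injI)
    fix u v assume "Psi \<pi> u = Psi \<pi> v"
    then have "Psi \<pi> (u - v) = 0" by (simp add: clinear_diff[OF algebra_homD(1)[OF *]])
    then show "u = v" using Psi_eq_0_imp by fastforce
  qed
qed

end
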